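(* Let $f:\mathbb{R}^n\to\mathbb{R}$ be convex and three times differentiable with $\|D^3f(x)-D^3f(y)\|\le L_f\|x-y\|$ for all $x,y\in\mathbb{R}^n$, let $\psi:\mathbb{R}^n\to\mathbb{R}\cup\{+\infty\}$ be a simple convex function, and let $\tilde f=f+\psi$ have a minimizer $x^*$. Let $x_0\in\mathrm{dom}\,\psi$ and suppose that $\max\{\|x-x^*\| : \tilde f(x)\le\tilde f(x_0)\}\le R_0$ with $R_0\in(0,+\infty)$. Let $\epsilon,M_0>0$ and run Algorithm 2 (described in the context). Let $x_{T+1}=x^+_{T,i_T}$ be the first trial point generated by Algorithm 2 such that $$\min\{\|\nabla\tilde f(x_{T+1})\|,\ \tilde f(x_{T+1})-\tilde f(x^* )\}\le\epsilon.$$ Let $m$ be the first iteration number such that $\tilde f(x_m)-\tilde f(x^* )\le 6^3\left(4\max\{2M_0,4L_f\}R_0^4\right)$ and assume that $T>m$. Then the total number $E_T$ of executions of Algorithm 1 (up to the $T$th iteration of Algorithm 2) is bounded as follows: $$E_T\le 2(m+1)+84\max\{4M_0,8L_f\}^{1/3}R_0^{4/3}\epsilon^{-1/3}+\log_2(\max\{2M_0,4L_f\})-\log_2(M_0),$$ where $m$ is bounded by $$m\le 1+\frac{1}{\log_2(4/3)}\log_2\log_2\left(\frac{\tilde f(x_0)-\tilde f(x^* )}{6^3\left(\max\{4M_0,8L_f\}R_0^4\right)}\right).$$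
   Context: $\|\cdot\|$ is the Euclidean norm on $\mathbb{R}^n$ and the induced norm on matrices and tensors. $\partial$ denotes the convex subdifferential; $\partial\tilde f(x)=\nabla f(x)+\partial\psi(x)$, and $\nabla\tilde f(x)$ denotes a chosen element of $\partial\tilde f(x)$. Models. $\Phi_x(y)=f(x)+\sum_{i=1}^3\frac1{i!}D^if(x)[y-x]^i$; for $M>0$, $\Omega_{x,M}(y)=\Phi_x(y)+\frac M8\|y-x\|^4$ and $\tilde\Omega_{x,M}=\Omega_{x,M}+\psi$. Also $\rho_x(y)=\frac12\langle\nabla^2f(x)(y-x),y-x\rangle+\frac M8\|y-x\|^4$ and $\beta_{\rho_x}(u,v)=\rho_x(v)-\rho_x(u)-\langle\nabla\rho_x(u),v-u\rangle$. Algorithm 1 (inner solver for approximately minimizing $\tilde\Omega_{x,M}$). Input: $x\in\mathrm{dom}\,\psi$, $\nabla\tilde f(x)\in\partial\tilde f(x)$, $M,\epsilon>0$. Step 0: set $L_{x,M}=\mathrm{trace}(\nabla^2f(x))+\frac{3M}2\left[\frac{96\|\nabla\tilde f(x)\|}{M}\right]^{2/3}$, $\beta_{x,M}=\frac12\mathrm{trace}(\nabla^2f(x))\left[\frac{96\|\nabla\tilde f(x)\|}{M}\right]^{2/3}+\frac M8\left[\frac{96\|\nabla\tilde f(x)\|}{M}\right]^{4/3}$, $y_0=x$, $\alpha=0$, $k=0$. Step 1: compute $y_{k+1}=\arg\min_{y\in\mathbb{R}^n}\{\langle\nabla\Omega_{x,M}(y_k),y-y_k\rangle+3\beta_{\rho_x}(y_k,y)+\psi(y)\}$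 and $g_\psi(y_{k+1})=-\nabla\Omega_{x,M}(y_k)+3[\nabla\rho_x(y_k)-\nabla\rho_x(y_{k+1})]$. Step 2: if $\|\nabla\Omega_{x,M}(y_{k+1})+g_\psi(y_{k+1})\|\le\epsilon/7$ or $\|\nabla\Omega_{x,M}(y_{k+1})+g_\psi(y_{k+1})\|\le\frac M6\|y_{k+1}-x\|^3$, set $x^+=y_{k+1}$ and stop. Step 3: if $\|\nabla\Omega_{x,M}(y_{k+1})+g_\psi(y_{k+1})\|^4>\frac{3^8L_{x,M}^4\beta_{x,M}}{2M(6/5)^k}$, set $x^+=y_{k+1}$, $\alpha=1$ and stop. Step 4: set $k:=k+1$ and go to Step 1. Output: $(x^+,\alpha)$, together with $g_\psi(x^+)$. Algorithm 2. Step 0: choose $x_0\in\mathrm{dom}\,\psi$, $M_0,\epsilon>0$; set $t=0$. Step 1: let $i$ be the smallest integer $\ge0$ with $2^iM_t\ge2M_0$. Step 1.1: apply Algorithm 1 with $x=x_t$, $M=2^iM_t$ and the same $\epsilon$; let $(x^+_{t,i},\alpha_{t,i})$ be its output and $\nabla\tilde f(x^+_{t,i})=\nabla f(x^+_{t,i})+g_\psi(x^+_{t,i})$. Step 1.2: if $\alpha_{t,i}=1$, set $i:=i+1$ and go to Step 1.1. Step 1.3: if $\|\nabla\tilde f(x^+_{t,i})\|\le\epsilon$, set $x_{t+1}=x^+_{t,i}$ and stop. Step 1.4: if $\tilde f(x_t)-\tilde f(x^+_{t,i})\ge\frac1{6(2^iM_t)^{1/3}}\|\nabla\tilde f(x^+_{t,i})\|^{4/3}$,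 set $i_t=i$ and go to Step 2; otherwise set $i:=i+1$ and go to Step 1.1. Step 2: set $x_{t+1}=x^+_{t,i_t}$, $M_{t+1}=2^{i_t-1}M_t$, $t:=t+1$, and go to Step 1. A trial point is any point $x^+_{t,i}$.
   Formalization: The bound on m is stated only for m ≥ 1: when m = 0 its right-hand side can be undefined or negative (e.g. a convex quadratic f with the argument of the inner logarithm slightly above 1), so the bound as displayed fails there. *)

theory Defs
  imports "HOL-Analysis.Analysis"
begin

section \<open>Derivatives\<close>

text \<open>Iterating \<open>fderiv\<close> gives the derivatives $D^i f(x)$ as nested bounded linear maps. The
  norm of \<open>'a \<Rightarrow>\<^sub>L 'b\<close> is the operator norm, so on the iterates it is the induced norm of
  multilinear forms.\<close>

definition fderiv :: "('a::real_normed_vector \<Rightarrow> 'b::real_normed_vector) \<Rightarrow> 'a \<Rightarrow> 'a \<Rightarrow>\<^sub>L 'b" where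
  "fderiv f x = Blinfun (frechet_derivative f (at x))"

definition three_times_differentiable :: "('a::real_normed_vector \<Rightarrow> 'b::real_normed_vector) \<Rightarrow> bool" where
  "three_times_differentiable f \<longleftrightarrow>
     (\<forall>x. f differentiable (at x)) \<and>
     (\<forall>x. fderiv f differentiable (at x)) \<and>
     (\<forall>x. fderiv (fderiv f) differentiable (at x))"

definition grad :: "('a::real_inner \<Rightarrow> real) \<Rightarrow> 'a \<Rightarrow> 'a" where
  "grad f x = (THE D. GDERIV f x :> D)"

definition hessian :: "(real^'n \<Rightarrow> real) \<Rightarrow> real^'n \<Rightarrow> real^'n^'n" where
  "hessian f x = jacobian (grad f) (at x)"


section \<open>Extended-valued convex functions\<close>

text \<open>In \<open>ereal\<close> we have $0 \cdot \infty = 0$, so the cases $u = 0$ and $v = 0$ are harmless.\<close>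

definition convex_ereal :: "('a::real_vector \<Rightarrow> ereal) \<Rightarrow> bool" where
  "convex_ereal \<psi> \<longleftrightarrow>
     (\<forall>x y. \<forall>u\<ge>0. \<forall>v\<ge>0. u + v = 1 \<longrightarrow>
        \<psi> (u *\<^sub>R x + v *\<^sub>R y) \<le> ereal u * \<psi> x + ereal v * \<psi> y)"

definition edom :: "('a \<Rightarrow> ereal) \<Rightarrow> 'a set" where
  "edom \<psi> = {x. \<psi> x < \<infinity>}"

definition subdifferential :: "('a::real_inner \<Rightarrow> ereal) \<Rightarrow> 'a \<Rightarrow> 'a set" where
  "subdifferential \<psi> x = {g. x \<in> edom \<psi> \<and> (\<forall>y. \<psi> x + ereal (g \<bullet> (y - x)) \<le> \<psi> y)}"

definition composite :: "('a \<Rightarrow> real) \<Rightarrow> ('a \<Rightarrow> ereal) \<Rightarrow> 'a \<Rightarrow> ereal" where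
  "composite f \<psi> x = ereal (f x) + \<psi> x"

definition composite_subdifferential ::
    "('a::real_inner \<Rightarrow> real) \<Rightarrow> ('a \<Rightarrow> ereal) \<Rightarrow> 'a \<Rightarrow> 'a set" where
  "composite_subdifferential f \<psi> x = (+) (grad f x) ` subdifferential \<psi> x"


section \<open>Models\<close>

definition taylor_model :: "('a::real_normed_vector \<Rightarrow> real) \<Rightarrow> 'a \<Rightarrow> 'a \<Rightarrow> real" where
  "taylor_model f x y =
     f x + blinfun_apply (fderiv f x) (y - x)
     + 1/2 * blinfun_apply (blinfun_apply (fderiv (fderiv f) x) (y - x)) (y - x)
     + 1/6 * blinfun_apply (blinfun_apply (blinfun_apply
               (fderiv (fderiv (fderiv f)) x) (y - x)) (y - x)) (y - x)"

definition quartic_model :: "('a::real_normed_vector \<Rightarrow> real) \<Rightarrow> 'a \<Rightarrow> real \<Rightarrow> 'a \<Rightarrow> real" where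
  "quartic_model f x M y = taylor_model f x y + M/8 * norm (y - x) ^ 4"

definition scaling_fun :: "(real^'n \<Rightarrow> real) \<Rightarrow> real^'n \<Rightarrow> real \<Rightarrow> real^'n \<Rightarrow> real" where
  "scaling_fun f x M y =
     1/2 * ((hessian f x *v (y - x)) \<bullet> (y - x)) + M/8 * norm (y - x) ^ 4"

definition bregman :: "('a::real_inner \<Rightarrow> real) \<Rightarrow> 'a \<Rightarrow> 'a \<Rightarrow> real" where
  "bregman \<rho> u v = \<rho> v - \<rho> u - grad \<rho> u \<bullet> (v - u)"


section \<open>The inner solver\<close>

text \<open>\<open>G\<close> is the chosen subgradient $\nabla\tilde f(x)$ of the composite objective.\<close>

definition L_const :: "(real^'n \<Rightarrow> real) \<Rightarrow> real^'n \<Rightarrow> real^'n \<Rightarrow> real \<Rightarrow> real" where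
  "L_const f x G M = trace (hessian f x) + 3 * M / 2 * (96 * norm G / M) powr (2/3)"

definition beta_const :: "(real^'n \<Rightarrow> real) \<Rightarrow> real^'n \<Rightarrow> real^'n \<Rightarrow> real \<Rightarrow> real" where
  "beta_const f x G M =
     1/2 * trace (hessian f x) * (96 * norm G / M) powr (2/3)
     + M/8 * (96 * norm G / M) powr (4/3)"

definition inner_step ::
    "(real^'n \<Rightarrow> real) \<Rightarrow> (real^'n \<Rightarrow> ereal) \<Rightarrow> real^'n \<Rightarrow> real \<Rightarrow> real^'n \<Rightarrow> real^'n \<Rightarrow> bool" where
  "inner_step f \<psi> x M y y' \<longleftrightarrow>
     is_arg_min
       (\<lambda>z. ereal (grad (quartic_model f x M) y \<bullet> (z - y)
                    + 3 * bregman (scaling_fun f x M) y z) + \<psi> z)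
       (\<lambda>_. True) y'"

definition g_psi :: "(real^'n \<Rightarrow> real) \<Rightarrow> real^'n \<Rightarrow> real \<Rightarrow> real^'n \<Rightarrow> real^'n \<Rightarrow> real^'n" where
  "g_psi f x M y y' =
     - grad (quartic_model f x M) y
     + 3 *\<^sub>R (grad (scaling_fun f x M) y - grad (scaling_fun f x M) y')"

definition residual :: "(real^'n \<Rightarrow> real) \<Rightarrow> real^'n \<Rightarrow> real \<Rightarrow> real^'n \<Rightarrow> real^'n \<Rightarrow> real" where
  "residual f x M y y' = norm (grad (quartic_model f x M) y' + g_psi f x M y y')"

definition inner_success ::
    "(real^'n \<Rightarrow> real) \<Rightarrow> real^'n \<Rightarrow> real \<Rightarrow> real \<Rightarrow> real^'n \<Rightarrow> real^'n \<Rightarrow> bool" where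
  "inner_success f x M \<epsilon> y y' \<longleftrightarrow>
     residual f x M y y' \<le> \<epsilon> / 7 \<or> residual f x M y y' \<le> M/6 * norm (y' - x) ^ 3"

definition inner_failure ::
    "(real^'n \<Rightarrow> real) \<Rightarrow> real^'n \<Rightarrow> real^'n \<Rightarrow> real \<Rightarrow> nat \<Rightarrow> real^'n \<Rightarrow> real^'n \<Rightarrow> bool" where
  "inner_failure f x G M k y y' \<longleftrightarrow>
     residual f x M y y' ^ 4
       > 3 ^ 8 * L_const f x G M ^ 4 * beta_const f x G M / (2 * M * (6/5) ^ k)"

text \<open>\<open>algorithm1 f \<psi> x G M \<epsilon> xp \<alpha> g\<close>: the inner solver started at \<open>x\<close> terminates and returns
  the point \<open>xp\<close>, the flag \<open>\<alpha>\<close> and the vector \<open>g\<close> $= g_\psi(x^+)$. Here \<open>k\<close> is the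
  value of the loop counter at termination; attainment of the minima in the steps that are
  carried out is part of the relation.\<close>

definition algorithm1 ::
    "(real^'n \<Rightarrow> real) \<Rightarrow> (real^'n \<Rightarrow> ereal) \<Rightarrow> real^'n \<Rightarrow> real^'n \<Rightarrow> real \<Rightarrow> real
      \<Rightarrow> real^'n \<Rightarrow> nat \<Rightarrow> real^'n \<Rightarrow> bool" where
  "algorithm1 f \<psi> x G M \<epsilon> xp \<alpha> g \<longleftrightarrow>
     (\<exists>y k. y 0 = x
        \<and> (\<forall>j\<le>k. inner_step f \<psi> x M (y j) (y (Suc j)))
        \<and> (\<forall>j<k. \<not> inner_success f x M \<epsilon> (y j) (y (Suc j))
                  \<and> \<not> inner_failure f x G M j (y j) (y (Suc j)))
        \<and> (if inner_success f x M \<epsilon> (y k) (y (Suc k)) then \<alpha> = 0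
            else inner_failure f x G M k (y k) (y (Suc k)) \<and> \<alpha> = 1)
        \<and> xp = y (Suc k)
        \<and> g = g_psi f x M (y k) (y (Suc k)))"


section \<open>The outer method\<close>

definition first_index :: "real \<Rightarrow> real \<Rightarrow> nat" where
  "first_index M\<^sub>0 M = (LEAST i. 2 ^ i * M \<ge> 2 * M\<^sub>0)"

definition sufficient_decrease ::
    "('a::real_normed_vector \<Rightarrow> real) \<Rightarrow> ('a \<Rightarrow> ereal) \<Rightarrow> 'a \<Rightarrow> real \<Rightarrow> 'a \<Rightarrow> 'a \<Rightarrow> bool" where
  "sufficient_decrease f \<psi> x M xp Gp \<longleftrightarrow>
     composite f \<psi> x - composite f \<psi> xp
       \<ge> ereal (1 / (6 * M powr (1/3)) * norm Gp powr (4/3))"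

text \<open>\<open>algorithm2 f \<psi> x\<^sub>0 M\<^sub>0 \<epsilon> T x G M i xp \<alpha> g\<close>: a run of the method that has
  completed the iterations $t < T$ and has reached trial \<open>i T\<close> of iteration \<open>T\<close>.

  \<^item> \<open>x t\<close>, \<open>M t\<close>, \<open>G t\<close> are $x_t$, $M_t$ and $\nabla\tilde f(x_t)$. The vector \<open>G 0\<close> is an arbitrary
    subgradient; afterwards \<open>G (Suc t)\<close> is the subgradient obtained for the accepted trial point.
  \<^item> \<open>xp t j\<close>, \<open>\<alpha> t j\<close>, \<open>g t j\<close> are the outputs $x^+_{t,j}$, $\alpha_{t,j}$, $g_\psi(x^+_{t,j})$ of the
    inner solver, constrained only for the trials that are carried out, i.e. for \<open>t \<le> T\<close> and
    \<open>first_index M\<^sub>0 (M t) \<le> j \<le> i t\<close>.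
  \<^item> For \<open>t < T\<close>, \<open>i t\<close> is the index $i_t$ of the accepted trial. In iteration \<open>T\<close> it is merely
    a trial that has been reached: its acceptance, its rejection and termination of the
    method at it are all left open.\<close>

definition algorithm2 ::
    "(real^'n \<Rightarrow> real) \<Rightarrow> (real^'n \<Rightarrow> ereal) \<Rightarrow> real^'n \<Rightarrow> real \<Rightarrow> real \<Rightarrow> nat
      \<Rightarrow> (nat \<Rightarrow> real^'n) \<Rightarrow> (nat \<Rightarrow> real^'n) \<Rightarrow> (nat \<Rightarrow> real) \<Rightarrow> (nat \<Rightarrow> nat)
      \<Rightarrow> (nat \<Rightarrow> nat \<Rightarrow> real^'n) \<Rightarrow> (nat \<Rightarrow> nat \<Rightarrow> nat) \<Rightarrow> (nat \<Rightarrow> nat \<Rightarrow> real^'n) \<Rightarrow> bool" where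
  "algorithm2 f \<psi> x\<^sub>0 M\<^sub>0 \<epsilon> T x G M i xp \<alpha> g \<longleftrightarrow>
     x 0 = x\<^sub>0 \<and> M 0 = M\<^sub>0 \<and> G 0 \<in> composite_subdifferential f \<psi> x\<^sub>0
     \<and> (\<forall>t\<le>T. first_index M\<^sub>0 (M t) \<le> i t)
     \<and> (\<forall>t\<le>T. \<forall>j\<in>{first_index M\<^sub>0 (M t)..i t}.
          algorithm1 f \<psi> (x t) (G t) (2 ^ j * M t) \<epsilon> (xp t j) (\<alpha> t j) (g t j))
     \<and> (\<forall>t\<le>T. \<forall>j\<in>{first_index M\<^sub>0 (M t)..<i t}.
          \<alpha> t j = 1 \<or>
          norm (grad f (xp t j) + g t j) > \<epsilon> \<and>
          \<not> sufficient_decrease f \<psi> (x t) (2 ^ j * M t) (xp t j) (grad f (xp t j) + g t j))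
     \<and> (\<forall>t<T.
          \<alpha> t (i t) = 0 \<and>
          norm (grad f (xp t (i t)) + g t (i t)) > \<epsilon> \<and>
          sufficient_decrease f \<psi> (x t) (2 ^ i t * M t) (xp t (i t))
            (grad f (xp t (i t)) + g t (i t)) \<and>
          x (Suc t) = xp t (i t) \<and>
          G (Suc t) = grad f (xp t (i t)) + g t (i t) \<and>
          M (Suc t) = 2 powi (int (i t) - 1) * M t)"

definition executions :: "real \<Rightarrow> (nat \<Rightarrow> real) \<Rightarrow> (nat \<Rightarrow> nat) \<Rightarrow> nat \<Rightarrow> (nat \<times> nat) set" where
  "executions M\<^sub>0 M i T = (SIGMA t:{..T}. {first_index M\<^sub>0 (M t)..i t})"

definition eps_solution ::
    "('a::real_normed_vector \<Rightarrow> real) \<Rightarrow> ('a \<Rightarrow> ereal) \<Rightarrow> 'a \<Rightarrow> real \<Rightarrow> 'a \<Rightarrow> 'a \<Rightarrow> bool" where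
  "eps_solution f \<psi> xs \<epsilon> y v \<longleftrightarrow>
     min (ereal (norm v)) (composite f \<psi> y - composite f \<psi> xs) \<le> ereal \<epsilon>"

end

theory Submission
  imports Defs
begin

text \<open>
  \<^bold>\<open>Inner solver.\<close> Since $f$ is convex, $\nabla^2 f(x + sh) \succeq 0$ for $s = \pm 2$ forces
  $|D^3 f(x)[h,w,w]| \le \frac12 D^2 f(x)[w,w] + L_f \|h\|^2 \|w\|^2$. Hence for $M \ge 4 L_f$
  both $\Omega_{x,M} - \frac12 \rho_x$ and $3\rho_x - \Omega_{x,M}$ are convex, and a step
  $y \mapsto y^+$ of the solver satisfies
  $\tilde\Omega(y^+) + 3\beta_\rho(y^+, z) \le \tilde\Omega(z) + \frac52 \beta_\rho(y, z)$.
  As $\psi$ need not be lower semicontinuous, the model may have no minimizer; taking for $z$ the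
  last iterate instead, $\beta_\rho(\cdot, z)$ contracts by $5/6$ in every step. The residual of a
  step is the increment of $\nabla(3\rho_x - \Omega_{x,M})$, which is Lipschitz on the ball that
  contains the iterates, while $\beta_\rho(u, v) \ge \frac{M}{32}\|u - v\|^4$. So the failure test
  never fires, and a successful output decreases the objective sufficiently.

  \<^bold>\<open>Outer method.\<close> It follows that every trial uses a constant at most
  $H = \max\{4M_0, 8L_f\}$, and the number of trials telescopes. The scaled gaps
  $a_t = (\tilde f(x_t) - \tilde f(x^*)) / (6^3 H R_0^4)$ satisfy
  $a_{t+1} + a_{t+1}^{4/3} \le a_t$. While $a_t > 2$ this gives $a_{t+1}^{4/3} \le a_t$,
  hence the doubly logarithmic bound on $m$; afterwards $a_t^{-1/3}$ grows by at least $1/7$ per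
  iteration.
\<close>

section \<open>Second-order calculus\<close>

lemma has_real_derivative_along_line:
  fixes F :: "'a::real_normed_vector \<Rightarrow> real"
  assumes "(F has_derivative F') (at (x + s *\<^sub>R h))"
  shows "((\<lambda>s. F (x + s *\<^sub>R h)) has_real_derivative F' h) (at s)"
proof -
  have lin: "linear F'"
    using assms by (simp add: has_derivative_bounded_linear bounded_linear.linear)
  have "((\<lambda>s. F (x + s *\<^sub>R h)) has_derivative (\<lambda>t. F' (t *\<^sub>R h))) (at s)"
    by (rule has_derivative_compose[of "\<lambda>s. x + s *\<^sub>R h", OF _ assms])
      (auto intro!: derivative_eq_intros)
  then show ?thesis
    by (simp add: has_field_derivative_def linear_cmul[OF lin] mult.commute[of _ "F' h"])
qed

text \<open>\<open>grad\<close> is a definite description, so both halves must be supplied: the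
  coordinates of \<open>F'\<close> in the orthonormal basis give a representing vector, and
  uniqueness of the derivative makes it the only one.\<close>

lemma inner_grad:
  fixes F :: "'a::euclidean_space \<Rightarrow> real"
  assumes "(F has_derivative F') (at y)"
  shows "grad F y \<bullet> w = F' w"
proof -
  have lin: "linear F'"
    using assms by (simp add: has_derivative_bounded_linear bounded_linear.linear)
  define D where "D = (\<Sum>b\<in>Basis. F' b *\<^sub>R b)"
  have D: "w \<bullet> D = F' w" for w
  proof -
    have "F' w = F' (\<Sum>b\<in>Basis. (w \<bullet> b) *\<^sub>R b)"
      by (simp add: euclidean_representation)
    also have "\<dots> = (\<Sum>b\<in>Basis. (w \<bullet> b) * F' b)"
      by (simp add: linear_sum[OF lin] linear_cmul[OF lin])
    finally show ?thesis
      by (simp add: D_def inner_sum_right mult.commute)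
  qed
  have gd: "GDERIV F y :> D"
    unfolding gderiv_def using assms by (simp add: D)
  have "grad F y = D"
    unfolding grad_def
  proof (rule the_equality, rule gd)
    fix E assume "GDERIV F y :> E"
    then have "(\<lambda>h. h \<bullet> E) = (\<lambda>h. h \<bullet> D)"
      using gd unfolding gderiv_def by (rule has_derivative_unique)
    then have "\<forall>h. h \<bullet> E = h \<bullet> D" by (simp add: fun_eq_iff)
    then show "E = D" using vector_eq_ldot by blast
  qed
  then show ?thesis by (simp add: D flip: inner_commute[of w])
qed

lemma has_derivative_fderiv:
  assumes "F differentiable (at x)"
  shows "(F has_derivative blinfun_apply (fderiv F x)) (at x)"
proof -
  have "(F has_derivative frechet_derivative F (at x)) (at x)"
    using assms by (simp add: frechet_derivative_works)
  moreover from this have "blinfun_apply (fderiv F x) = frechet_derivative F (at x)"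
    by (simp add: fderiv_def bounded_linear_Blinfun_apply has_derivative_bounded_linear)
  ultimately show ?thesis by simp
qed

text \<open>The mean value theorem twice: along \<open>a\<close> for the increment of
  \<open>F\<close> in direction \<open>b\<close>, then along \<open>b\<close> for the directional
  derivative. In \<open>F'' y b a\<close> the first slot is the direction of the second
  differentiation.\<close>

lemma second_difference_mean_value:
  fixes F :: "'a::real_normed_vector \<Rightarrow> real"
  assumes F: "\<And>y. (F has_derivative F' y) (at y)"
    and F': "\<And>y. ((\<lambda>y. F' y a) has_derivative (\<lambda>b. F'' y b a)) (at y)"
    and s: "s > 0"
  obtains \<xi> where "dist \<xi> x \<le> s * (norm a + norm b)"
    and "F (x + s *\<^sub>R a + s *\<^sub>R b) - F (x + s *\<^sub>R a) - F (x + s *\<^sub>R b) + F x = s * s * F'' \<xi> b a"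
proof -
  define \<phi> where "\<phi> r = F ((x + s *\<^sub>R b) + r *\<^sub>R a) - F (x + r *\<^sub>R a)" for r
  have d\<phi>: "(\<phi> has_real_derivative (F' ((x + s *\<^sub>R b) + r *\<^sub>R a) a - F' (x + r *\<^sub>R a) a)) (at r)" for r
    unfolding \<phi>_def by (intro DERIV_diff has_real_derivative_along_line F)
  from MVT2[OF s, of \<phi>, OF d\<phi>] obtain r where r: "0 < r" "r < s"
    and 1: "\<phi> s - \<phi> 0 = (s - 0) * (F' ((x + s *\<^sub>R b) + r *\<^sub>R a) a - F' (x + r *\<^sub>R a) a)"
    by auto
  have d2: "((\<lambda>q. F' ((x + r *\<^sub>R a) + q *\<^sub>R b) a) has_real_derivative F'' ((x + r *\<^sub>R a) + q *\<^sub>R b) b a) (at q)" for q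
    by (rule has_real_derivative_along_line[OF F'])
  from MVT2[OF s, of "\<lambda>q. F' ((x + r *\<^sub>R a) + q *\<^sub>R b) a", OF d2] obtain q where q: "0 < q" "q < s"
    and 2: "F' ((x + r *\<^sub>R a) + s *\<^sub>R b) a - F' ((x + r *\<^sub>R a) + 0 *\<^sub>R b) a
            = (s - 0) * F'' ((x + r *\<^sub>R a) + q *\<^sub>R b) b a"
    by auto
  show thesis
  proof (rule that)
    have "dist (x + r *\<^sub>R a + q *\<^sub>R b) x = norm (r *\<^sub>R a + q *\<^sub>R b)"
      by (simp add: dist_norm)
    also have "\<dots> \<le> r * norm a + q * norm b"
      using norm_triangle_ineq[of "r *\<^sub>R a" "q *\<^sub>R b"] r q by simp
    also have "\<dots> \<le> s * (norm a + norm b)"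
      using r q by (simp add: distrib_left add_mono mult_right_mono)
    finally show "dist (x + r *\<^sub>R a + q *\<^sub>R b) x \<le> s * (norm a + norm b)" .
    have "F (x + s *\<^sub>R a + s *\<^sub>R b) - F (x + s *\<^sub>R a) - F (x + s *\<^sub>R b) + F x = \<phi> s - \<phi> 0"
      by (simp add: \<phi>_def algebra_simps)
    also have "\<dots> = s * s * F'' (x + r *\<^sub>R a + q *\<^sub>R b) b a"
      using 1 2 by (simp add: algebra_simps)
    finally show "F (x + s *\<^sub>R a + s *\<^sub>R b) - F (x + s *\<^sub>R a) - F (x + s *\<^sub>R b) + F x
                  = s * s * F'' (x + r *\<^sub>R a + q *\<^sub>R b) b a" .
  qed
qed

text \<open>The second difference is symmetric in \<open>a\<close> and \<open>b\<close>. Mean values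
  in both orders yield two points near \<open>x\<close> with
  \<open>F'' \<xi> b a = F'' \<eta> a b\<close>, and continuity carries the equality to
  \<open>x\<close>.\<close>

lemma symmetric_second_derivative:
  fixes F :: "'a::real_normed_vector \<Rightarrow> real"
  assumes F: "\<And>y. (F has_derivative F' y) (at y)"
    and F': "\<And>y w. ((\<lambda>y. F' y w) has_derivative (\<lambda>v. F'' y v w)) (at y)"
    and cont: "\<And>v w. isCont (\<lambda>y. F'' y v w) x"
  shows "F'' x a b = F'' x b a"
proof (rule ccontr)
  assume "F'' x a b \<noteq> F'' x b a"
  then have e: "\<bar>F'' x a b - F'' x b a\<bar> / 2 > 0" (is "?e > 0") by simp
  obtain d1 where d1: "d1 > 0" "\<And>y. dist y x < d1 \<Longrightarrow> dist (F'' y a b) (F'' x a b) < ?e"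
    using cont[of a b] e unfolding continuous_at_eps_delta by blast
  obtain d2 where d2: "d2 > 0" "\<And>y. dist y x < d2 \<Longrightarrow> dist (F'' y b a) (F'' x b a) < ?e"
    using cont[of b a] e unfolding continuous_at_eps_delta by blast
  define K where "K = norm a + norm b + 1"
  define s where "s = min d1 d2 / K"
  have K: "K > 0" by (simp add: K_def add_nonneg_pos)
  have s: "s > 0" using d1 d2 K by (simp add: s_def)
  have small: "s * (norm a + norm b) < min d1 d2"
  proof -
    have "s * (norm a + norm b) < s * K" using s by (simp add: K_def)
    also have "\<dots> = min d1 d2" using K by (simp add: s_def)
    finally show ?thesis .
  qed
  obtain \<xi> where \<xi>: "dist \<xi> x \<le> s * (norm a + norm b)"
    "F (x + s *\<^sub>R a + s *\<^sub>R b) - F (x + s *\<^sub>R a) - F (x + s *\<^sub>R b) + F x = s * s * F'' \<xi> b a"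
    using second_difference_mean_value[of F F' a F'' s x b, OF F F' s] by blast
  obtain \<eta> where \<eta>: "dist \<eta> x \<le> s * (norm b + norm a)"
    "F (x + s *\<^sub>R b + s *\<^sub>R a) - F (x + s *\<^sub>R b) - F (x + s *\<^sub>R a) + F x = s * s * F'' \<eta> a b"
    using second_difference_mean_value[of F F' b F'' s x a, OF F F' s] by blast
  have "s * s * F'' \<xi> b a = s * s * F'' \<eta> a b"
    unfolding \<xi>(2)[symmetric] \<eta>(2)[symmetric] by (simp add: algebra_simps)
  then have "F'' \<xi> b a = F'' \<eta> a b" using s by simp
  moreover have "dist (F'' \<xi> b a) (F'' x b a) < ?e" using \<xi>(1) small d2(2) by simp
  moreover have "dist (F'' \<eta> a b) (F'' x a b) < ?e" using \<eta>(1) small d1(2) by (simp add: add.commute)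
  ultimately show False by (simp add: dist_real_def abs_if split: if_splits)
qed

text \<open>Integration of a power bound without integrals: the antiderivative of the bound minus
  \<open>r\<close> is nondecreasing. Taylor estimates come from iterating it.\<close>

lemma le_of_deriv_le_power:
  fixes r :: "real \<Rightarrow> real"
  assumes r: "\<And>s. (r has_real_derivative r' s) (at s)"
    and bound: "\<And>s. 0 \<le> s \<Longrightarrow> r' s \<le> c + K * s ^ n" and t: "0 \<le> t"
  shows "r t \<le> r 0 + c * t + K * t ^ Suc n / Suc n"
proof -
  define k where "k s = r 0 + c * s + K * s ^ Suc n / Suc n - r s" for s
  have "k 0 \<le> k t"
  proof (rule DERIV_nonneg_imp_nondecreasing[OF t])
    fix s :: real assume "0 \<le> s"
    have "(k has_real_derivative c + K * s ^ n - r' s) (at s)"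
      unfolding k_def by (auto intro!: derivative_eq_intros r simp del: power_Suc)
    then show "\<exists>y. (k has_real_derivative y) (at s) \<and> 0 \<le> y"
      using bound[OF \<open>0 \<le> s\<close>] by (intro exI[of _ "c + K * s ^ n - r' s"]) simp
  qed
  then show ?thesis by (simp add: k_def)
qed

lemma above_tangent:
  fixes F :: "'a::real_normed_vector \<Rightarrow> real"
  assumes F: "\<And>y. (F has_derivative F' y) (at y)"
    and F': "\<And>y w. ((\<lambda>y. F' y w) has_derivative (\<lambda>v. F'' y v w)) (at y)"
    and nonneg: "\<And>y w. F'' y w w \<ge> 0"
  shows "F u + F' u (v - u) \<le> F v"
proof -
  let ?w = "v - u"
  have 1: "((\<lambda>s. F (u + s *\<^sub>R ?w)) has_real_derivative F' (u + s *\<^sub>R ?w) ?w) (at s)" for s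
    by (rule has_real_derivative_along_line[OF F])
  have 2: "((\<lambda>s. F' (u + s *\<^sub>R ?w) ?w) has_real_derivative F'' (u + s *\<^sub>R ?w) ?w ?w) (at s)" for s
    by (rule has_real_derivative_along_line[OF F'])
  have mono: "F' (u + 0 *\<^sub>R ?w) ?w \<le> F' (u + s *\<^sub>R ?w) ?w" if "0 \<le> s" for s
    by (rule DERIV_nonneg_imp_nondecreasing[OF that]) (use 2 nonneg in blast)
  \<comment> \<open>The bound is applied to \<open>- F\<close> with \<open>K = 0\<close>, since the
    slope along the segment never falls below its initial value.\<close>
  have "- F (u + 1 *\<^sub>R ?w) \<le> - F (u + 0 *\<^sub>R ?w) + - F' u ?w * 1 + 0 * 1 ^ Suc 0 / Suc 0"
    by (rule le_of_deriv_le_power[OF DERIV_minus[OF 1]]) (use mono in auto)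
  then show ?thesis by simp
qed

text \<open>For a positive semidefinite symmetric form, a bound on the diagonal also bounds mixed
  values: evaluate the form at the difference of two unit vectors. The mean value theorem is applied
  to the component of the gradient along \<open>w\<close>, the gradient difference itself.\<close>

lemma gradient_lipschitz_on_cball:
  fixes F :: "'a::euclidean_space \<Rightarrow> real"
  assumes F: "\<And>y. (F has_derivative F' y) (at y)"
    and F': "\<And>y w. ((\<lambda>y. F' y w) has_derivative (\<lambda>v. F'' y v w)) (at y)"
    and bilin: "\<And>y. bilinear (F'' y)"
    and sym: "\<And>y v w. F'' y v w = F'' y w v"
    and nonneg: "\<And>y w. F'' y w w \<ge> 0"
    and upper: "\<And>y w. y \<in> cball x r \<Longrightarrow> F'' y w w \<le> C * norm w ^ 2"
    and u: "u \<in> cball x r" and v: "v \<in> cball x r"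
  shows "norm (grad F u - grad F v) \<le> C * norm (u - v)"
proof (cases "u = v \<or> grad F u = grad F v")
  case True
  have "C \<ge> 0"
  proof -
    obtain b :: 'a where "b \<in> Basis" using nonempty_Basis by blast
    then show ?thesis using order_trans[OF nonneg[of u b] upper[OF u, of b]] by simp
  qed
  with True show ?thesis by auto
next
  case False
  define a where "a = u - v"
  define w where "w = grad F u - grad F v"
  have ne: "norm a > 0" "norm w > 0" using False by (auto simp: a_def w_def)
  have 2: "((\<lambda>s. F' (v + s *\<^sub>R a) w) has_real_derivative F'' (v + s *\<^sub>R a) a w) (at s)" for s
    by (rule has_real_derivative_along_line[OF F'])
  from MVT2[of 0 1 "\<lambda>s. F' (v + s *\<^sub>R a) w", OF _ 2] obtain s where s: "0 < s" "s < 1"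
    and eq: "F' (v + 1 *\<^sub>R a) w - F' (v + 0 *\<^sub>R a) w = (1 - 0) * F'' (v + s *\<^sub>R a) a w"
    by auto
  define y where "y = v + s *\<^sub>R a"
  have y: "y \<in> cball x r"
  proof -
    have "y = (1 - s) *\<^sub>R v + s *\<^sub>R u" by (simp add: y_def a_def algebra_simps)
    then show ?thesis
      using convexD_alt[OF convex_cball v u, of s] s by simp
  qed
  have main: "norm w ^ 2 = F'' y a w"
  proof -
    have "norm w ^ 2 = grad F u \<bullet> w - grad F v \<bullet> w"
      by (simp add: power2_norm_eq_inner w_def inner_diff_left)
    also have "\<dots> = F' u w - F' v w" by (simp add: inner_grad[OF F])
    finally show ?thesis using eq by (simp add: a_def y_def)
  qed
  note bl = bilinear_lmul[OF bilin] bilinear_rmul[OF bilin] bilinear_ladd[OF bilin]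
    bilinear_radd[OF bilin] bilinear_lsub[OF bilin] bilinear_rsub[OF bilin]
  let ?a = "(1 / norm a) *\<^sub>R a" and ?w = "(1 / norm w) *\<^sub>R w"
  have n1: "norm ?a = 1" "norm ?w = 1" using ne by auto
  have "0 \<le> F'' y (?a - ?w) (?a - ?w)" by (rule nonneg)
  also have "\<dots> = F'' y ?a ?a + F'' y ?w ?w - 2 * F'' y ?a ?w"
    unfolding bl(5,6) using sym[of y ?a ?w] by simp
  also have "\<dots> \<le> 2 * C - 2 * F'' y ?a ?w"
    using upper[OF y, of ?a] upper[OF y, of ?w] unfolding n1 by simp
  finally have "F'' y ?a ?w \<le> C" by simp
  then have "F'' y a w / (norm a * norm w) \<le> C" unfolding bl by (simp add: mult.commute[of "norm w"])
  then have "F'' y a w \<le> C * (norm a * norm w)" using ne by (simp add: pos_divide_le_eq)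
  then have "norm w * norm w \<le> (C * norm a) * norm w"
    by (simp add: main[symmetric] power2_eq_square mult_ac)
  then show ?thesis using ne by (simp add: a_def w_def)
qed

text \<open>\<open>h\<close> is only differentiable at \<open>y\<close>. Convexity of
  \<open>\<psi>\<close> bounds the objective on the segment to \<open>z\<close> by a function with
  the same value at \<open>y\<close> and with a derivative there, which cannot be negative. The
  point \<open>x\<close> keeps the minimal value below infinity.\<close>

lemma minimizer_subgradient:
  fixes \<psi> :: "'a::euclidean_space \<Rightarrow> ereal"
  assumes min: "is_arg_min (composite h \<psi>) (\<lambda>_. True) y"
    and h: "(h has_derivative h') (at y)"
    and proper: "\<And>u. \<psi> u \<noteq> -\<infinity>" and convex: "convex_ereal \<psi>" and dom: "x \<in> edom \<psi>"
  shows "- grad h y \<in> subdifferential \<psi> y"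
proof -
  have le: "composite h \<psi> y \<le> composite h \<psi> z" for z
    using min by (auto simp: is_arg_min_def not_less)
  have y: "y \<in> edom \<psi>"
    using le[of x] dom by (cases "\<psi> x"; cases "\<psi> y") (auto simp: composite_def edom_def)
  then obtain d where d: "\<psi> y = ereal d" using proper[of y] by (cases "\<psi> y") (auto simp: edom_def)
  have "\<psi> y + ereal (- grad h y \<bullet> (z - y)) \<le> \<psi> z" for z
  proof (cases "\<psi> z")
    case PInf then show ?thesis by simp
  next
    case MInf then show ?thesis using proper[of z] by simp
  next
    case (real c)
    let ?e = "z - y"
    define k where "k t = h (y + t *\<^sub>R ?e) + t * (c - d)" for t
    have "((\<lambda>t. h (y + t *\<^sub>R ?e)) has_real_derivative h' ?e) (at 0)"
      by (rule has_real_derivative_along_line) (use h in simp)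
    then have dk: "(k has_real_derivative h' ?e + (c - d)) (at 0)"
      unfolding k_def by (auto intro!: derivative_eq_intros)
    have ge: "k 0 \<le> k t" if t: "0 < t" "t < 1" for t
    proof -
      have "\<psi> (t *\<^sub>R z + (1 - t) *\<^sub>R y) \<le> ereal t * \<psi> z + ereal (1 - t) * \<psi> y"
        using convex t by (auto simp: convex_ereal_def)
      also have "t *\<^sub>R z + (1 - t) *\<^sub>R y = y + t *\<^sub>R ?e" by (simp add: algebra_simps)
      finally have *: "\<psi> (y + t *\<^sub>R ?e) \<le> ereal (t * c + (1 - t) * d)" by (simp add: real d)
      then obtain e where e: "\<psi> (y + t *\<^sub>R ?e) = ereal e"
        using proper[of "y + t *\<^sub>R ?e"] by (cases "\<psi> (y + t *\<^sub>R ?e)") auto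
      have "h y + d \<le> h (y + t *\<^sub>R ?e) + e"
        using le[of "y + t *\<^sub>R ?e"] by (simp add: composite_def d e)
      moreover have "e \<le> t * c + (1 - t) * d" using * by (simp only: e ereal_less_eq)
      ultimately show ?thesis by (simp add: k_def algebra_simps)
    qed
    have "0 \<le> h' ?e + (c - d)"
    proof (rule ccontr)
      assume "\<not> ?thesis"
      then obtain \<delta> where \<delta>: "\<delta> > 0" "\<And>t. 0 < t \<Longrightarrow> t < \<delta> \<Longrightarrow> k (0 + t) < k 0"
        using DERIV_neg_dec_right[OF dk] by auto
      define t where "t = min \<delta> 1 / 2"
      have "0 < t" "t < \<delta>" "t < 1" using \<delta>(1) by (auto simp: t_def min_def)
      with \<delta>(2)[of t] ge[of t] show False by simp
    qed
    then show ?thesis by (simp add: d real inner_grad[OF h])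
  qed
  with y show ?thesis by (simp add: subdifferential_def)
qed

section \<open>Convex functions with Lipschitz third derivative\<close>

locale lipschitz_third_derivative =
  fixes f :: "'a::euclidean_space \<Rightarrow> real" and L :: real
  assumes convex_f: "convex_on UNIV f"
    and diff_f: "three_times_differentiable f"
    and lipschitz_f: "\<And>u v. norm (fderiv (fderiv (fderiv f)) u - fderiv (fderiv (fderiv f)) v)
                              \<le> L * norm (u - v)"
begin

abbreviation D1 :: "'a \<Rightarrow> 'a \<Rightarrow> real" where
  "D1 y u \<equiv> blinfun_apply (fderiv f y) u"

abbreviation D2 :: "'a \<Rightarrow> 'a \<Rightarrow> 'a \<Rightarrow> real" where
  "D2 y u v \<equiv> blinfun_apply (blinfun_apply (fderiv (fderiv f) y) u) v"

abbreviation D3 :: "'a \<Rightarrow> 'a \<Rightarrow> 'a \<Rightarrow> 'a \<Rightarrow> real" where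
  "D3 y u v w \<equiv> blinfun_apply (blinfun_apply (blinfun_apply (fderiv (fderiv (fderiv f)) y) u) v) w"

section \<open>Derivatives of f up to order three, their symmetry and sign\<close>

lemma has_derivative_D1: "(f has_derivative D1 y) (at y)"
  using diff_f by (auto simp: three_times_differentiable_def intro: has_derivative_fderiv)

lemma has_derivative_D2_blinfun:
  "(fderiv f has_derivative blinfun_apply (fderiv (fderiv f) y)) (at y)"
  using diff_f by (auto simp: three_times_differentiable_def intro: has_derivative_fderiv)

lemma has_derivative_D3_blinfun:
  "(fderiv (fderiv f) has_derivative blinfun_apply (fderiv (fderiv (fderiv f)) y)) (at y)"
  using diff_f by (auto simp: three_times_differentiable_def intro: has_derivative_fderiv)

lemma has_derivative_D2: "((\<lambda>y. D1 y w) has_derivative (\<lambda>v. D2 y v w)) (at y)"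
  by (rule bounded_linear.has_derivative[OF blinfun.bounded_linear_left has_derivative_D2_blinfun])

lemma has_derivative_D3: "((\<lambda>y. D2 y v w) has_derivative (\<lambda>u. D3 y u v w)) (at y)"
  by (intro bounded_linear.has_derivative[OF blinfun.bounded_linear_left] has_derivative_D3_blinfun)

lemma L_nonneg: "L \<ge> 0"
proof -
  obtain b :: 'a where b: "b \<in> Basis" using nonempty_Basis by blast
  have "0 \<le> L * norm (b - 0)"
    using lipschitz_f[of b 0] norm_ge_zero order_trans by blast
  then show ?thesis using b by simp
qed

lemma D3_diff_le: "D3 y u v w - D3 x u v w \<le> L * norm (y - x) * norm u * norm v * norm w"
proof -
  let ?T = "fderiv (fderiv (fderiv f)) y - fderiv (fderiv (fderiv f)) x"
  have "D3 y u v w - D3 x u v w \<le> norm (blinfun_apply (blinfun_apply (blinfun_apply ?T u) v) w)"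
    by (simp add: blinfun.diff_left)
  also have "\<dots> \<le> norm (blinfun_apply (blinfun_apply ?T u) v) * norm w"
    by (rule norm_blinfun)
  also have "\<dots> \<le> norm (blinfun_apply ?T u) * norm v * norm w"
    by (intro mult_right_mono norm_blinfun) simp
  also have "\<dots> \<le> norm ?T * norm u * norm v * norm w"
    by (intro mult_right_mono norm_blinfun) simp_all
  also have "\<dots> \<le> L * norm (y - x) * norm u * norm v * norm w"
    by (intro mult_right_mono lipschitz_f) simp_all
  finally show ?thesis .
qed

lemma isCont_D3: "isCont (\<lambda>y. D3 y u v w) x"
proof -
  have "isCont (fderiv (fderiv (fderiv f))) x"
    unfolding continuous_at_eps_delta
  proof (intro allI impI)
    fix e :: real assume e: "e > 0"
    have "dist (fderiv (fderiv (fderiv f)) y) (fderiv (fderiv (fderiv f)) x) < e"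
      if "dist y x < e / (L + 1)" for y
    proof -
      have "dist (fderiv (fderiv (fderiv f)) y) (fderiv (fderiv (fderiv f)) x) \<le> L * dist y x"
        using lipschitz_f[of y x] by (simp add: dist_norm)
      also have "\<dots> \<le> (L + 1) * dist y x" by (intro mult_right_mono) auto
      also have "\<dots> < e" using that L_nonneg by (simp add: pos_less_divide_eq mult.commute)
      finally show ?thesis .
    qed
    then show "\<exists>d>0. \<forall>y. dist y x < d \<longrightarrow>
        dist (fderiv (fderiv (fderiv f)) y) (fderiv (fderiv (fderiv f)) x) < e"
      using e L_nonneg by (intro exI[of _ "e / (L + 1)"]) auto
  qed
  then show ?thesis by (intro continuous_intros)
qed

lemma D2_sym: "D2 y u v = D2 y v u"
proof (rule symmetric_second_derivative[OF has_derivative_D1 has_derivative_D2])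
  show "isCont (\<lambda>y. D2 y v w) x" for v w x
    by (rule has_derivative_continuous[OF has_derivative_D3])
qed

lemma D3_sym12: "D3 y u v w = D3 y v u w"
  by (rule symmetric_second_derivative[OF has_derivative_D2 has_derivative_D3 isCont_D3])

text \<open>Symmetry in the last two slots is inherited: differentiate the symmetry of
  \<open>D2\<close> and use uniqueness of the derivative.\<close>

lemma D3_sym23: "D3 y u v w = D3 y u w v"
proof -
  have "(\<lambda>u. D3 y u v w) = (\<lambda>u. D3 y u w v)"
    by (rule has_derivative_unique[OF has_derivative_D3[of v w y]])
      (use has_derivative_D3[of w v y] in \<open>simp add: D2_sym[of _ w v]\<close>)
  then show ?thesis by metis
qed

text \<open>Adding the values at opposite points around \<open>y\<close> cancels the first-order
  term, so negative curvature would make \<open>q\<close> drop just to the right of 0, against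
  midpoint convexity.\<close>

lemma D2_nonneg: "D2 y w w \<ge> 0"
proof (rule ccontr)
  assume neg: "\<not> ?thesis"
  define q where "q s = f (y + s *\<^sub>R w) + f (y + s *\<^sub>R (- w))" for s
  define q' where "q' s = D1 (y + s *\<^sub>R w) w + D1 (y + s *\<^sub>R (- w)) (- w)" for s
  have dq: "(q has_real_derivative q' s) (at s)" for s
    unfolding q_def q'_def
    by (intro DERIV_add has_real_derivative_along_line has_derivative_D1)
  have dq': "(q' has_real_derivative D2 (y + 0 *\<^sub>R w) w w + D2 (y + 0 *\<^sub>R (- w)) (- w) (- w)) (at 0)"
    unfolding q'_def
    by (intro DERIV_add has_real_derivative_along_line has_derivative_D2)
  have "D2 (y + 0 *\<^sub>R w) w w + D2 (y + 0 *\<^sub>R (- w)) (- w) (- w) < 0"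
    using neg by (simp add: blinfun.minus_left blinfun.minus_right)
  from DERIV_neg_dec_right[OF dq' this] obtain d
    where d: "d > 0" "\<And>s. 0 < s \<Longrightarrow> s < d \<Longrightarrow> q' (0 + s) < q' 0" by auto
  obtain s where s: "0 < s" "s < d / 2" "q (d / 2) - q 0 = (d / 2 - 0) * q' s"
    using MVT2[of 0 "d/2" q q'] dq d(1) by auto
  have "q' 0 = 0" by (simp add: q'_def blinfun.minus_right)
  then have "q' s < 0" using d(2)[of s] s(1,2) d(1) by simp
  then have "(d / 2 - 0) * q' s < 0" using d(1) by (simp add: mult_pos_neg)
  then have "q (d / 2) < q 0" using s(3) by simp
  moreover have "2 * f ((1/2) *\<^sub>R (y + (d/2) *\<^sub>R w) + (1/2) *\<^sub>R (y + (d/2) *\<^sub>R (- w))) \<le> q (d / 2)"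
    using convex_onD[OF convex_f, of "1/2" "y + (d/2) *\<^sub>R w" "y + (d/2) *\<^sub>R (- w)"]
    by (simp add: q_def)
  moreover have "(1/2) *\<^sub>R (y + (d/2) *\<^sub>R w) + (1/2) *\<^sub>R (y + (d/2) *\<^sub>R (- w)) = y"
    by (simp add: scaleR_half_double flip: scaleR_add_right)
  ultimately show False by (simp add: q_def)
qed

lemma D1_above_tangent: "f u + D1 u (v - u) \<le> f v"
  by (rule above_tangent[OF has_derivative_D1 has_derivative_D2 D2_nonneg])

lemma abs_D3_le: "\<bar>D3 x h w w\<bar> \<le> D2 x w w / 2 + L * norm h ^ 2 * norm w ^ 2"
proof -
  have *: "- D3 x k w w \<le> D2 x w w / 2 + L * norm k ^ 2 * norm w ^ 2" for k
  proof -
    have d: "((\<lambda>s. D2 (x + s *\<^sub>R k) w w) has_real_derivative D3 (x + s *\<^sub>R k) k w w) (at s)" for s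
      by (rule has_real_derivative_along_line[OF has_derivative_D3])
    have b: "D3 (x + s *\<^sub>R k) k w w \<le> D3 x k w w + (L * norm k ^ 2 * norm w ^ 2) * s ^ 1"
      if "0 \<le> s" for s
      using D3_diff_le[of "x + s *\<^sub>R k" k w w x] that by (simp add: power2_eq_square mult_ac)
    \<comment> \<open>With step length \<open>s\<close>, nonnegativity of \<open>D2\<close> at the
      far end gives the coefficients \<open>1/s\<close> and \<open>L * s / 2\<close>; the choice 2
      yields \<open>1/2\<close> and \<open>L\<close>.\<close>
    have "D2 (x + 2 *\<^sub>R k) w w \<le> D2 (x + 0 *\<^sub>R k) w w + D3 x k w w * 2
        + (L * norm k ^ 2 * norm w ^ 2) * 2 ^ Suc 1 / Suc 1"
      by (rule le_of_deriv_le_power[OF d b]) auto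
    then show ?thesis using D2_nonneg[of "x + 2 *\<^sub>R k" w] by simp
  qed
  show ?thesis using *[of h] *[of "-h"] by (simp add: blinfun.minus_left blinfun.minus_right abs_le_iff)
qed

lemma D1_taylor:
  "D1 (x + h) w - (D1 x w + D2 x h w + D3 x h h w / 2) \<le> L / 6 * norm h ^ 3 * norm w"
proof -
  define K where "K = L * norm h ^ 3 * norm w"
  have d2: "((\<lambda>s. D2 (x + s *\<^sub>R h) h w) has_real_derivative D3 (x + s *\<^sub>R h) h h w) (at s)" for s
    by (rule has_real_derivative_along_line[OF has_derivative_D3])
  have b2: "D3 (x + s *\<^sub>R h) h h w \<le> D3 x h h w + K * s ^ 1" if "0 \<le> s" for s
    using D3_diff_le[of "x + s *\<^sub>R h" h h w x] that
    by (simp add: K_def power3_eq_cube mult_ac)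
  \<comment> \<open>Subtracting the quadratic part leaves a derivative bound of the form
    \<open>c + K * s ^ n\<close>, so that the integration lemma applies a second time.\<close>
  have d1: "((\<lambda>s. D1 (x + s *\<^sub>R h) w - D3 x h h w * s\<^sup>2 / 2)
      has_real_derivative D2 (x + s *\<^sub>R h) h w - D3 x h h w * s) (at s)" for s
    by (rule DERIV_diff[OF has_real_derivative_along_line[OF has_derivative_D2]])
      (auto intro!: derivative_eq_intros)
  have b1: "D2 (x + s *\<^sub>R h) h w - D3 x h h w * s \<le> D2 x h w + (K / 2) * s ^ 2" if "0 \<le> s" for s
    using le_of_deriv_le_power[OF d2 b2 that] by (simp add: numeral_2_eq_2)
  have "D1 (x + 1 *\<^sub>R h) w - D3 x h h w * 1\<^sup>2 / 2
      \<le> (D1 (x + 0 *\<^sub>R h) w - D3 x h h w * 0\<^sup>2 / 2) + D2 x h w * 1 + (K / 2) * 1 ^ Suc 2 / Suc 2"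
    by (rule le_of_deriv_le_power[OF d1 b1]) auto
  then show ?thesis by (simp add: K_def)
qed

text \<open>The family is closed under linear combinations and contains $\Omega_{x,M}$ as
  \<open>quartic 1 1 1 M x\<close> and $\rho_x$ as \<open>quartic 0 1 0 M x\<close>; \<open>quartic'\<close> and \<open>quartic''\<close> are the
  first two derivatives.\<close>

definition quartic :: "real \<Rightarrow> real \<Rightarrow> real \<Rightarrow> real \<Rightarrow> 'a \<Rightarrow> 'a \<Rightarrow> real" where
  "quartic c p q r x y = c * (f x + D1 x (y - x)) + p / 2 * D2 x (y - x) (y - x)
     + q / 6 * D3 x (y - x) (y - x) (y - x) + r / 8 * norm (y - x) ^ 4"

definition quartic' :: "real \<Rightarrow> real \<Rightarrow> real \<Rightarrow> real \<Rightarrow> 'a \<Rightarrow> 'a \<Rightarrow> 'a \<Rightarrow> real" where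
  "quartic' c p q r x y w = c * D1 x w + p * D2 x (y - x) w + q / 2 * D3 x (y - x) (y - x) w
     + r / 2 * ((y - x) \<bullet> (y - x)) * ((y - x) \<bullet> w)"

definition quartic'' :: "real \<Rightarrow> real \<Rightarrow> real \<Rightarrow> 'a \<Rightarrow> 'a \<Rightarrow> 'a \<Rightarrow> 'a \<Rightarrow> real" where
  "quartic'' p q r x y v w = p * D2 x v w + q * D3 x (y - x) v w
     + r / 2 * (((y - x) \<bullet> (y - x)) * (v \<bullet> w) + 2 * ((y - x) \<bullet> v) * ((y - x) \<bullet> w))"

section \<open>Calculus and curvature of the quartic family\<close>

lemma has_derivative_linear_term: "((\<lambda>y. D1 x (y - x)) has_derivative (\<lambda>v. D1 x v)) (at y)"
  by (rule bounded_linear.has_derivative[OF blinfun.bounded_linear_right])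
    (auto intro!: derivative_eq_intros)

lemma has_derivative_D2_left: "((\<lambda>y. D2 x (y - x) w) has_derivative (\<lambda>v. D2 x v w)) (at y)"
  by (rule bounded_linear.has_derivative[OF bounded_linear_compose[OF blinfun.bounded_linear_left
          blinfun.bounded_linear_right]])
    (auto intro!: derivative_eq_intros)

lemma has_derivative_quadratic_term:
  "((\<lambda>y. D2 x (y - x) (y - x)) has_derivative (\<lambda>v. 2 * D2 x (y - x) v)) (at y)"
proof -
  have 1: "((\<lambda>y. blinfun_apply (fderiv (fderiv f) x) (y - x)) has_derivative
      (\<lambda>v. blinfun_apply (fderiv (fderiv f) x) v)) (at y)"
    by (rule bounded_linear.has_derivative[OF blinfun.bounded_linear_right])
      (auto intro!: derivative_eq_intros)
  have 2: "((\<lambda>y. y - x) has_derivative (\<lambda>v. v)) (at y)"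
    by (auto intro!: derivative_eq_intros)
  show ?thesis
    by (rule has_derivative_eq_rhs[OF blinfun.FDERIV[OF 1 2]]) (simp add: D2_sym[of x _ "y - x"])
qed

lemma has_derivative_D3_diagonal:
  "((\<lambda>y. D3 x (y - x) (y - x) w) has_derivative (\<lambda>v. 2 * D3 x (y - x) v w)) (at y)"
proof -
  have 1: "((\<lambda>y. blinfun_apply (fderiv (fderiv (fderiv f)) x) (y - x)) has_derivative
      (\<lambda>v. blinfun_apply (fderiv (fderiv (fderiv f)) x) v)) (at y)"
    by (rule bounded_linear.has_derivative[OF blinfun.bounded_linear_right])
      (auto intro!: derivative_eq_intros)
  have 2: "((\<lambda>y. y - x) has_derivative (\<lambda>v. v)) (at y)"
    by (auto intro!: derivative_eq_intros)
  show ?thesis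
    by (rule has_derivative_eq_rhs[OF bounded_linear.has_derivative[OF blinfun.bounded_linear_left
            blinfun.FDERIV[OF 1 2]]])
      (simp add: blinfun.add_left D3_sym12[of x _ "y - x"])
qed

lemma has_derivative_cubic_term:
  "((\<lambda>y. D3 x (y - x) (y - x) (y - x)) has_derivative (\<lambda>v. 3 * D3 x (y - x) (y - x) v)) (at y)"
proof -
  have 1: "((\<lambda>y. blinfun_apply (fderiv (fderiv (fderiv f)) x) (y - x)) has_derivative
      (\<lambda>v. blinfun_apply (fderiv (fderiv (fderiv f)) x) v)) (at y)"
    by (rule bounded_linear.has_derivative[OF blinfun.bounded_linear_right])
      (auto intro!: derivative_eq_intros)
  have 2: "((\<lambda>y. y - x) has_derivative (\<lambda>v. v)) (at y)"
    by (auto intro!: derivative_eq_intros)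
  show ?thesis
  proof (rule has_derivative_eq_rhs[OF blinfun.FDERIV[OF blinfun.FDERIV[OF 1 2] 2]], rule ext)
    fix v
    show "D3 x (y - x) (y - x) v
        + blinfun_apply (blinfun_apply (blinfun_apply (fderiv (fderiv (fderiv f)) x) (y - x)) v
          + blinfun_apply (blinfun_apply (fderiv (fderiv (fderiv f)) x) v) (y - x)) (y - x)
        = 3 * D3 x (y - x) (y - x) v"
      unfolding blinfun.add_left D3_sym12[of x v "y - x" "y - x"] D3_sym23[of x "y - x" v "y - x"]
      by simp
  qed
qed

lemma has_derivative_norm_square:
  "((\<lambda>y. (y - x) \<bullet> (y - x)) has_derivative (\<lambda>v. 2 * ((y - x) \<bullet> v))) (at (y::'a))"
proof -
  have 1: "((\<lambda>y. y - x) has_derivative (\<lambda>v. v)) (at y)"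
    by (auto intro!: derivative_eq_intros)
  show ?thesis
    by (rule has_derivative_eq_rhs[OF has_derivative_inner[OF 1 1]])
      (simp add: inner_commute[of _ "y - x"])
qed

lemma has_derivative_norm_power4:
  "((\<lambda>y. norm (y - x) ^ 4) has_derivative (\<lambda>v. 4 * ((y - x) \<bullet> (y - x)) * ((y - x) \<bullet> v))) (at (y::'a))"
proof -
  have n: "norm h ^ 4 = (h \<bullet> h) ^ 2" for h :: 'a
    by (simp add: dot_square_norm flip: power_mult)
  show ?thesis
    unfolding n
    by (rule has_derivative_eq_rhs[OF has_derivative_power[OF has_derivative_norm_square, where n = 2]])
      (simp add: fun_eq_iff)
qed

lemma quartic_has_derivative:
  "(quartic c p q r x has_derivative quartic' c p q r x y) (at y)"
proof -
  have "((\<lambda>y. c * (f x + D1 x (y - x)) + p / 2 * D2 x (y - x) (y - x)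
      + q / 6 * D3 x (y - x) (y - x) (y - x) + r / 8 * norm (y - x) ^ 4) has_derivative
     (\<lambda>v. c * (0 + D1 x v) + p / 2 * (2 * D2 x (y - x) v) + q / 6 * (3 * D3 x (y - x) (y - x) v)
        + r / 8 * (4 * ((y - x) \<bullet> (y - x)) * ((y - x) \<bullet> v)))) (at y)"
    by (intro has_derivative_add has_derivative_mult_right has_derivative_const
        has_derivative_linear_term has_derivative_quadratic_term has_derivative_cubic_term
        has_derivative_norm_power4)
  then show ?thesis
    unfolding quartic_def[abs_def] quartic'_def[abs_def]
    by (rule has_derivative_eq_rhs) (simp add: fun_eq_iff)
qed

lemma quartic'_has_derivative:
  "((\<lambda>y. quartic' c p q r x y w) has_derivative (\<lambda>v. quartic'' p q r x y v w)) (at y)"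
proof -
  have 1: "((\<lambda>y. ((y - x) \<bullet> (y - x)) * ((y - x) \<bullet> w)) has_derivative
     (\<lambda>v. ((y - x) \<bullet> (y - x)) * (v \<bullet> w) + 2 * ((y - x) \<bullet> v) * ((y - x) \<bullet> w))) (at y)"
  proof -
    have 2: "((\<lambda>y. (y - x) \<bullet> w) has_derivative (\<lambda>v. v \<bullet> w)) (at y)"
      by (auto intro!: derivative_eq_intros)
    show ?thesis
      by (rule has_derivative_eq_rhs[OF has_derivative_mult[OF has_derivative_norm_square 2]])
        (simp add: mult_ac)
  qed
  have "((\<lambda>y. c * D1 x w + p * D2 x (y - x) w + q / 2 * D3 x (y - x) (y - x) w
      + r / 2 * (((y - x) \<bullet> (y - x)) * ((y - x) \<bullet> w))) has_derivative
     (\<lambda>v. 0 + p * D2 x v w + q / 2 * (2 * D3 x (y - x) v w)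
        + r / 2 * (((y - x) \<bullet> (y - x)) * (v \<bullet> w) + 2 * ((y - x) \<bullet> v) * ((y - x) \<bullet> w)))) (at y)"
    by (intro has_derivative_add has_derivative_mult_right has_derivative_const
        has_derivative_D2_left has_derivative_D3_diagonal 1)
  then show ?thesis
    unfolding quartic'_def[abs_def] quartic''_def[abs_def]
    by (simp add: mult.assoc)
qed

text \<open>\<open>abs_D3_le\<close> splits the cubic term into a share of the quadratic form and a
  share of the quartic term; the two hypotheses say that \<open>p\<close> and \<open>r\<close> can
  pay for them. The rank-one part of the quartic Hessian is nonnegative and dropped.\<close>

lemma quartic''_nonneg:
  assumes pq: "\<bar>q\<bar> \<le> 2 * p" and qr: "2 * \<bar>q\<bar> * L \<le> r"
  shows "quartic'' p q r x y w w \<ge> 0"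
proof -
  let ?h = "y - x"
  have "- (q * D3 x ?h w w) \<le> \<bar>q\<bar> * \<bar>D3 x ?h w w\<bar>"
    using abs_ge_minus_self[of "q * D3 x ?h w w"] unfolding abs_mult .
  also have "\<dots> \<le> \<bar>q\<bar> * (D2 x w w / 2 + L * norm ?h ^ 2 * norm w ^ 2)"
    by (intro mult_left_mono abs_D3_le) simp
  also have "\<dots> = \<bar>q\<bar> / 2 * D2 x w w + (2 * \<bar>q\<bar> * L) / 2 * (norm ?h ^ 2 * norm w ^ 2)"
    by (simp add: algebra_simps)
  also have "\<dots> \<le> p * D2 x w w + r / 2 * (norm ?h ^ 2 * norm w ^ 2)"
    using pq qr D2_nonneg by (intro add_mono mult_right_mono) auto
  finally have 1: "0 \<le> p * D2 x w w + q * D3 x ?h w w + r / 2 * (norm ?h ^ 2 * norm w ^ 2)"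
    by simp
  have "0 \<le> 2 * \<bar>q\<bar> * L" using L_nonneg by simp
  then have "0 \<le> r" using qr by linarith
  then have "0 \<le> r / 2 * (2 * (?h \<bullet> w) * (?h \<bullet> w))"
    by (simp add: mult.assoc)
  with 1 show ?thesis
    by (simp add: quartic''_def power2_norm_eq_inner distrib_left)
qed

lemma quartic_above_tangent:
  assumes "\<bar>q\<bar> \<le> 2 * p" and "2 * \<bar>q\<bar> * L \<le> r"
  shows "quartic c p q r x u + quartic' c p q r x u (v - u) \<le> quartic c p q r x v"
  by (rule above_tangent[OF quartic_has_derivative quartic'_has_derivative quartic''_nonneg[OF assms]])

lemma quartic''_sym: "quartic'' p q r x y v w = quartic'' p q r x y w v"
  unfolding quartic''_def D2_sym[of x v w] D3_sym23[of x _ v w] inner_commute[of v w]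
  by (simp only: mult_ac)

lemma bilinear_quartic'': "bilinear (quartic'' p q r x y)"
proof -
  have lin: "linear (quartic'' p q r x y v)" for v
  proof (rule linearI)
    fix a b and c :: real
    show "quartic'' p q r x y v (a + b) = quartic'' p q r x y v a + quartic'' p q r x y v b"
      by (simp only: quartic''_def blinfun.add_right inner_add_right distrib_left add_ac)
    show "quartic'' p q r x y v (c *\<^sub>R a) = c *\<^sub>R quartic'' p q r x y v a"
      by (simp only: quartic''_def blinfun.scaleR_right inner_scaleR_right real_scaleR_def
        distrib_left mult.left_commute[of _ c])
  qed
  have "(\<lambda>v. quartic'' p q r x y v w) = quartic'' p q r x y w" for w
    by (simp only: quartic''_sym[of p q r x y _ w])
  with lin show ?thesis by (simp add: bilinear_def)
qed

lemma quartic_grad_lipschitz: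
  assumes pq: "\<bar>q\<bar> \<le> 2 * p" and qr: "2 * \<bar>q\<bar> * L \<le> r"
    and trace: "\<And>w. D2 x w w \<le> t * norm w ^ 2"
    and u: "u \<in> cball x d" and v: "v \<in> cball x d"
  shows "norm (grad (quartic c p q r x) u - grad (quartic c p q r x) v)
    \<le> ((p + \<bar>q\<bar> / 2) * t + (\<bar>q\<bar> * L + 3 / 2 * r) * d ^ 2) * norm (u - v)"
proof (rule gradient_lipschitz_on_cball[where F' = "quartic' c p q r x"
      and F'' = "quartic'' p q r x" and x = x and r = d])
  show "(quartic c p q r x has_derivative quartic' c p q r x y) (at y)" for y
    by (rule quartic_has_derivative)
  show "((\<lambda>y. quartic' c p q r x y w) has_derivative (\<lambda>v. quartic'' p q r x y v w)) (at y)" for y w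
    by (rule quartic'_has_derivative)
  show "bilinear (quartic'' p q r x y)" for y
    by (rule bilinear_quartic'')
  show "quartic'' p q r x y v w = quartic'' p q r x y w v" for y v w
    by (rule quartic''_sym)
  show "0 \<le> quartic'' p q r x y w w" for y w
    by (rule quartic''_nonneg[OF pq qr])
  show "u \<in> cball x d" "v \<in> cball x d" by fact+
  fix y w assume y: "y \<in> cball x d"
  define h where "h = y - x"
  have h: "norm h ^ 2 \<le> d ^ 2"
    using y by (intro power_mono) (auto simp: h_def dist_norm norm_minus_commute)
  have "0 \<le> 2 * \<bar>q\<bar> * L" using L_nonneg by simp
  then have r: "0 \<le> r" using qr by linarith
  have "q * D3 x h w w \<le> \<bar>q\<bar> * \<bar>D3 x h w w\<bar>"
    using abs_ge_self[of "q * D3 x h w w"] unfolding abs_mult .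
  also have "\<dots> \<le> \<bar>q\<bar> * (D2 x w w / 2 + L * norm h ^ 2 * norm w ^ 2)"
    by (intro mult_left_mono abs_D3_le) simp
  finally have 1: "q * D3 x h w w \<le> \<bar>q\<bar> / 2 * D2 x w w + \<bar>q\<bar> * L * (norm h ^ 2 * norm w ^ 2)"
    by (simp add: algebra_simps)
  \<comment> \<open>By Cauchy-Schwarz the rank-one part is at most twice the isotropic part, whence
    the factor 3.\<close>
  have "(h \<bullet> w) * (h \<bullet> w) \<le> (norm h * norm w) ^ 2"
    using power_mono[OF Cauchy_Schwarz_ineq2[of h w], of 2] by (simp add: power2_eq_square)
  then have 2: "r / 2 * ((h \<bullet> h) * (w \<bullet> w) + 2 * (h \<bullet> w) * (h \<bullet> w))
      \<le> r / 2 * (3 * (norm h ^ 2 * norm w ^ 2))"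
    using r by (auto intro!: mult_left_mono simp: power_mult_distrib power2_norm_eq_inner)
  have "quartic'' p q r x y w w
      \<le> (p + \<bar>q\<bar> / 2) * D2 x w w + (\<bar>q\<bar> * L + 3 / 2 * r) * (norm h ^ 2 * norm w ^ 2)"
    using add_mono[OF 1 2] unfolding quartic''_def h_def[symmetric]
    by (simp only: distrib_left distrib_right mult.assoc mult.left_commute[of 3])
  also have "\<dots> \<le> (p + \<bar>q\<bar> / 2) * (t * norm w ^ 2) + (\<bar>q\<bar> * L + 3 / 2 * r) * (d ^ 2 * norm w ^ 2)"
  proof (intro add_mono)
    show "(p + \<bar>q\<bar> / 2) * D2 x w w \<le> (p + \<bar>q\<bar> / 2) * (t * norm w ^ 2)"
      using pq by (intro mult_left_mono trace) linarith
    have "0 \<le> \<bar>q\<bar> * L + 3 / 2 * r" using r L_nonneg by simp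
    then show "(\<bar>q\<bar> * L + 3 / 2 * r) * (norm h ^ 2 * norm w ^ 2)
        \<le> (\<bar>q\<bar> * L + 3 / 2 * r) * (d ^ 2 * norm w ^ 2)"
      by (intro mult_left_mono mult_right_mono h) simp_all
  qed
  finally show "quartic'' p q r x y w w
      \<le> ((p + \<bar>q\<bar> / 2) * t + (\<bar>q\<bar> * L + 3 / 2 * r) * d ^ 2) * norm w ^ 2"
    by (simp add: algebra_simps)
qed

end

section \<open>Relative smoothness of the quartic model\<close>

text \<open>\<open>B\<close> is not assumed symmetric, so the double sum is averaged with its
  transpose. Positivity at \<open>(w \<bullet> c) *\<^sub>R b - (w \<bullet> b) *\<^sub>R c\<close>
  bounds each symmetrized term by diagonal entries.\<close>

lemma psd_le_trace:
  fixes B :: "'a::euclidean_space \<Rightarrow> 'a \<Rightarrow> real"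
  assumes bl: "bilinear B" and nonneg: "\<And>w. B w w \<ge> 0"
  shows "B w w \<le> (\<Sum>b\<in>Basis. B b b) * norm w ^ 2"
proof -
  note bls = bilinear_lmul[OF bl] bilinear_rmul[OF bl] bilinear_lsub[OF bl] bilinear_rsub[OF bl]
  have lin1: "linear (\<lambda>v. B v u)" and lin2: "linear (B u)" for u
    using bl by (auto simp: bilinear_def)
  have ex: "B w w = (\<Sum>b\<in>Basis. \<Sum>c\<in>Basis. (w \<bullet> b) * (w \<bullet> c) * B b c)"
  proof -
    have "B w w = B (\<Sum>b\<in>Basis. (w \<bullet> b) *\<^sub>R b) w" by (simp add: euclidean_representation)
    also have "\<dots> = (\<Sum>b\<in>Basis. (w \<bullet> b) * B b w)"
      by (simp add: linear_sum[OF lin1] linear_cmul[OF lin1])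
    also have "\<dots> = (\<Sum>b\<in>Basis. (w \<bullet> b) * B b (\<Sum>c\<in>Basis. (w \<bullet> c) *\<^sub>R c))"
      by (simp add: euclidean_representation)
    also have "\<dots> = (\<Sum>b\<in>Basis. \<Sum>c\<in>Basis. (w \<bullet> b) * (w \<bullet> c) * B b c)"
      by (simp add: linear_sum[OF lin2] linear_cmul[OF lin2] sum_distrib_left mult.assoc)
    finally show ?thesis .
  qed
  have swap: "B w w = (\<Sum>b\<in>Basis. \<Sum>c\<in>Basis. (w \<bullet> b) * (w \<bullet> c) * B c b)"
    unfolding ex by (subst sum.swap) (simp add: mult_ac)
  have mixed: "(w \<bullet> b) * (w \<bullet> c) * B b c + (w \<bullet> b) * (w \<bullet> c) * B c b
      \<le> (w \<bullet> c)\<^sup>2 * B b b + (w \<bullet> b)\<^sup>2 * B c c" for b c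
    using nonneg[of "(w \<bullet> c) *\<^sub>R b - (w \<bullet> b) *\<^sub>R c"] unfolding bls
    by (simp add: algebra_simps power2_eq_square)
  have "2 * B w w = (\<Sum>b\<in>Basis. \<Sum>c\<in>Basis.
      (w \<bullet> b) * (w \<bullet> c) * B b c + (w \<bullet> b) * (w \<bullet> c) * B c b)"
    unfolding sum.distrib using ex swap by linarith
  also have "\<dots> \<le> (\<Sum>b\<in>Basis. \<Sum>c\<in>Basis. (w \<bullet> c)\<^sup>2 * B b b + (w \<bullet> b)\<^sup>2 * B c c)"
    by (intro sum_mono mixed)
  also have "\<dots> = 2 * ((\<Sum>b\<in>Basis. B b b) * (\<Sum>c\<in>Basis. (w \<bullet> c)\<^sup>2))"
  proof -
    have "(\<Sum>b\<in>Basis. \<Sum>c\<in>Basis. (w \<bullet> c)\<^sup>2 * B b b) = (\<Sum>c\<in>Basis. (w \<bullet> c)\<^sup>2) * (\<Sum>b\<in>Basis. B b b)"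
      by (simp only: sum_distrib_left sum_distrib_right)
    moreover have "(\<Sum>b\<in>Basis. \<Sum>c\<in>Basis. (w \<bullet> b)\<^sup>2 * B c c) = (\<Sum>c\<in>Basis. (w \<bullet> c)\<^sup>2) * (\<Sum>b\<in>Basis. B b b)"
      by (simp only: sum_product)
    ultimately show ?thesis by (simp add: sum.distrib)
  qed
  also have "(\<Sum>c\<in>Basis. (w \<bullet> c)\<^sup>2) = norm w ^ 2"
    unfolding power2_norm_eq_inner by (subst euclidean_inner) (simp only: power2_eq_square)
  finally show ?thesis by simp
qed

lemma norm_power4_above_tangent:
  fixes u v :: "'a::real_inner"
  shows "norm u ^ 4 + 4 * (u \<bullet> u) * (u \<bullet> (v - u)) + norm (v - u) ^ 4 / 4 \<le> norm v ^ 4"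
proof -
  define e where "e = v - u"
  define A where "A = u \<bullet> u"
  define p where "p = u \<bullet> e"
  define E where "E = e \<bullet> e"
  have n: "norm h ^ 4 = (h \<bullet> h) ^ 2" for h :: 'a
    by (simp add: dot_square_norm flip: power_mult)
  have v: "v \<bullet> v = A + 2 * p + E"
    by (simp add: A_def p_def E_def e_def inner_diff_left inner_diff_right inner_commute)
  have "p\<^sup>2 \<le> A * E" unfolding A_def E_def p_def by (rule Cauchy_Schwarz_ineq)
  \<comment> \<open>After \<open>A * E\<close> is replaced by \<open>p\<^sup>2\<close>, the
    difference of the two sides is \<open>6 * p\<^sup>2 + 4 * p * E + 3/4 * E\<^sup>2\<close>, whose
    completed square appears here.\<close>
  moreover have "0 \<le> 6 * (p + E / 3)\<^sup>2 + E\<^sup>2 / 12" by simp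
  ultimately have "A\<^sup>2 + 4 * A * p + E\<^sup>2 / 4 \<le> (A + 2 * p + E)\<^sup>2"
    by (simp add: power2_eq_square algebra_simps)
  then show ?thesis
    unfolding n v e_def[symmetric] A_def[symmetric] p_def[symmetric] E_def[symmetric] .
qed

section \<open>Gradient, Hessian matrix and trace in coordinates\<close>

locale lipschitz_third_derivative_vec = lipschitz_third_derivative f L
  for f :: "real^'n \<Rightarrow> real" and L
begin

lemma inner_grad_f: "grad f y \<bullet> w = D1 y w"
  by (rule inner_grad[OF has_derivative_D1])

text \<open>Links the matrix, defined as a Jacobian, to the nested derivative: expand
  \<open>grad f\<close> in the basis and differentiate each coefficient.\<close>

lemma inner_hessian: "(hessian f x *v w) \<bullet> u = D2 x w u"
proof -
  have eq: "grad f = (\<lambda>y. \<Sum>b\<in>Basis. D1 y b *\<^sub>R b)"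
    by (rule ext) (simp add: euclidean_representation flip: inner_grad_f)
  have d: "(grad f has_derivative (\<lambda>v. \<Sum>b\<in>Basis. D2 x v b *\<^sub>R b)) (at x)"
    unfolding eq by (intro has_derivative_sum has_derivative_scaleR_left has_derivative_D2)
  have "(grad f has_derivative (\<lambda>h. jacobian (grad f) (at x) *v h)) (at x)"
    using d jacobian_works differentiable_def by blast
  then have "(\<lambda>h. hessian f x *v h) = (\<lambda>v. \<Sum>b\<in>Basis. D2 x v b *\<^sub>R b)"
    unfolding hessian_def by (rule has_derivative_unique[OF _ d])
  then have "(hessian f x *v w) \<bullet> u = (\<Sum>b\<in>Basis. D2 x w b *\<^sub>R b) \<bullet> u" by metis
  also have "\<dots> = D2 x w (\<Sum>b\<in>Basis. (u \<bullet> b) *\<^sub>R b)"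
    by (simp add: inner_sum_left blinfun.sum_right blinfun.scaleR_right inner_commute[of u] mult.commute)
  finally show ?thesis by (simp add: euclidean_representation)
qed

lemma trace_hessian: "trace (hessian f x) = (\<Sum>b\<in>Basis. D2 x b b)"
proof -
  have "hessian f x $ i $ i = D2 x (axis i 1) (axis i 1)" for i
    by (simp add: inner_axis matrix_vector_mul_component inner_axis' flip: inner_hessian)
  moreover have "(\<Sum>b\<in>Basis. D2 x b b) = (\<Sum>i\<in>UNIV. D2 x (axis i 1) (axis i (1::real)))"
    by (rule sum.reindex_bij_betw[symmetric])
      (auto simp: bij_betw_def inj_on_def axis_eq_axis Basis_vec_def)
  ultimately show ?thesis by (simp add: trace_def)
qed

lemma D2_le_trace: "D2 x w w \<le> trace (hessian f x) * norm w ^ 2"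
  unfolding trace_hessian
  by (rule psd_le_trace[OF _ D2_nonneg])
    (auto simp: bilinear_def blinfun.add_left blinfun.add_right blinfun.scaleR_left
      blinfun.scaleR_right intro!: linearI)

lemma trace_hessian_nonneg: "0 \<le> trace (hessian f x)"
  unfolding trace_hessian by (intro sum_nonneg D2_nonneg)

lemma quartic_model_eq: "quartic_model f x M = quartic 1 1 1 M x"
  by (simp add: fun_eq_iff quartic_model_def taylor_model_def quartic_def)

lemma scaling_fun_eq: "scaling_fun f x M = quartic 0 1 0 M x"
  by (simp add: fun_eq_iff scaling_fun_def inner_hessian quartic_def)

lemma inner_grad_quartic: "grad (quartic c p q r x) y \<bullet> w = quartic' c p q r x y w"
  by (rule inner_grad[OF quartic_has_derivative])

section \<open>Bregman distance of the scaling function\<close>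

lemma bregman_eq:
  "bregman (scaling_fun f x M) u v
     = quartic 0 1 0 M x v - quartic 0 1 0 M x u - quartic' 0 1 0 M x u (v - u)"
  by (simp add: bregman_def scaling_fun_eq inner_grad_quartic)

lemma bregman_self: "bregman (scaling_fun f x M) u u = 0"
  by (simp add: bregman_def)

lemma bregman_center: "bregman (scaling_fun f x M) x v = scaling_fun f x M v"
  unfolding bregman_eq unfolding scaling_fun_eq by (simp add: quartic_def quartic'_def)

text \<open>The constant is \<open>M/8\<close> times the \<open>1/4\<close> of
  \<open>norm_power4_above_tangent\<close>; the quadratic part contributes half of
  \<open>D2 x (b - a) (b - a)\<close>, which is nonnegative.\<close>

lemma bregman_uniformly_convex:
  assumes "M > 0"
  shows "M / 32 * norm (v - u) ^ 4 \<le> bregman (scaling_fun f x M) u v"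
proof -
  define a where "a = u - x"
  define b where "b = v - x"
  have vu: "v - u = b - a" by (simp add: a_def b_def)
  have B: "D2 x b b - D2 x a a - 2 * D2 x a (b - a) = D2 x (b - a) (b - a)"
    by (simp add: blinfun.diff_left blinfun.diff_right D2_sym[of x b a])
  have "bregman (scaling_fun f x M) u v
      = 1/2 * (D2 x b b - D2 x a a - 2 * D2 x a (b - a))
        + M/8 * (norm b ^ 4 - norm a ^ 4 - 4 * (a \<bullet> a) * (a \<bullet> (b - a)))"
    unfolding bregman_eq quartic_def quartic'_def vu a_def[symmetric] b_def[symmetric]
    by (simp add: right_diff_distrib distrib_left diff_divide_distrib)
  also have "\<dots> \<ge> 0 + M/8 * (norm (b - a) ^ 4 / 4)"
    unfolding B using norm_power4_above_tangent[of a b] D2_nonneg[of x "b - a"] assms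
    by (intro add_mono mult_left_mono) auto
  finally show ?thesis by (simp add: vu)
qed

lemma bregman_nonneg: "M > 0 \<Longrightarrow> 0 \<le> bregman (scaling_fun f x M) u v"
  by (rule order_trans[OF _ bregman_uniformly_convex]) auto

text \<open>The model minus half the scaling function lies in the quartic family, and both convexity
  conditions are tight: \<open>\<bar>q\<bar> = 2 * p\<close>, while \<open>2 * L \<le> M/2\<close>
  is the assumption on \<open>M\<close>.\<close>

lemma quartic_model_relative_lower:
  assumes "M > 0" "4 * L \<le> M"
  shows "quartic_model f x M u + grad (quartic_model f x M) u \<bullet> (v - u)
           + 1/2 * bregman (scaling_fun f x M) u v \<le> quartic_model f x M v"
proof -
  have 1: "quartic 1 (1/2) 1 (M/2) x y = quartic 1 1 1 M x y - 1/2 * quartic 0 1 0 M x y" for y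
    by (simp add: quartic_def field_simps)
  have 2: "quartic' 1 (1/2) 1 (M/2) x y w = quartic' 1 1 1 M x y w - 1/2 * quartic' 0 1 0 M x y w" for y w
    by (simp add: quartic'_def field_simps)
  have "quartic 1 (1/2) 1 (M/2) x u + quartic' 1 (1/2) 1 (M/2) x u (v - u) \<le> quartic 1 (1/2) 1 (M/2) x v"
    by (rule quartic_above_tangent) (use assms in auto)
  then show ?thesis
    unfolding quartic_model_eq inner_grad_quartic bregman_eq 1 2 by (simp add: field_simps)
qed

lemma quartic_model_relative_upper:
  assumes "M > 0" "4 * L \<le> M"
  shows "quartic_model f x M v \<le> quartic_model f x M u + grad (quartic_model f x M) u \<bullet> (v - u)
           + 3 * bregman (scaling_fun f x M) u v"
proof -
  have 1: "quartic (-1) 2 (-1) (2*M) x y = 3 * quartic 0 1 0 M x y - quartic 1 1 1 M x y" for y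
    by (simp add: quartic_def field_simps)
  have 2: "quartic' (-1) 2 (-1) (2*M) x y w = 3 * quartic' 0 1 0 M x y w - quartic' 1 1 1 M x y w" for y w
    by (simp add: quartic'_def field_simps)
  have "quartic (-1) 2 (-1) (2*M) x u + quartic' (-1) 2 (-1) (2*M) x u (v - u) \<le> quartic (-1) 2 (-1) (2*M) x v"
    by (rule quartic_above_tangent) (use assms in auto)
  then show ?thesis
    unfolding quartic_model_eq inner_grad_quartic bregman_eq 1 2 by (simp add: field_simps)
qed

lemma residual_le:
  assumes M: "M > 0" "4 * L \<le> M"
    and y: "y \<in> cball x d" "y' \<in> cball x d"
  shows "residual f x M y y' \<le> 3 * (trace (hessian f x) + 3 * M / 2 * d ^ 2) * norm (y' - y)"
proof -
  let ?q = "quartic (-1) 2 (-1) (2*M) x"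
  have 2: "quartic' (-1) 2 (-1) (2*M) x y w = 3 * quartic' 0 1 0 M x y w - quartic' 1 1 1 M x y w" for y w
    by (simp add: quartic'_def field_simps)
  have "grad (quartic_model f x M) y' + g_psi f x M y y' = grad ?q y - grad ?q y'"
    by (rule vector_eq_rdot[THEN iffD1, rule_format])
      (simp add: g_psi_def inner_add_left inner_diff_left scaling_fun_eq quartic_model_eq
        inner_grad_quartic 2 right_diff_distrib)
  then have "residual f x M y y' = norm (grad ?q y - grad ?q y')"
    by (simp add: residual_def)
  also have "\<dots> \<le> ((2 + \<bar>-1\<bar> / 2) * trace (hessian f x) + (\<bar>-1\<bar> * L + 3 / 2 * (2 * M)) * d ^ 2) * norm (y - y')"
    by (rule quartic_grad_lipschitz[OF _ _ D2_le_trace y]) (use M in auto)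
  also have "\<dots> \<le> (3 * (trace (hessian f x) + 3 * M / 2 * d ^ 2)) * norm (y - y')"
  proof (rule mult_right_mono)
    \<comment> \<open>Rounding \<open>5/2\<close> up to 3 and \<open>L + 3 * M\<close> up to
      \<open>9/2 * M\<close> brings the bound to three times the shape of
      \<open>L_const\<close>.\<close>
    have "(L + 3 * M) * d ^ 2 \<le> (9 / 2 * M) * d ^ 2" using M by (intro mult_right_mono) auto
    then show "(2 + \<bar>-1\<bar> / 2) * trace (hessian f x) + (\<bar>-1\<bar> * L + 3 / 2 * (2 * M)) * d ^ 2
        \<le> 3 * (trace (hessian f x) + 3 * M / 2 * d ^ 2)"
      using trace_hessian_nonneg[of x] by (simp add: algebra_simps)
  qed simp
  finally show ?thesis by (simp add: norm_minus_commute)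
qed

lemma inner_step_progress:
  assumes M: "M > 0" "4 * L \<le> M"
    and g: "g_psi f x M y y' \<in> subdifferential \<psi> y'"
    and z: "\<psi> z = ereal c" and y': "\<psi> y' = ereal d"
  shows "quartic_model f x M y' + d + 3 * bregman (scaling_fun f x M) y' z
    \<le> quartic_model f x M z + c + 5/2 * bregman (scaling_fun f x M) y z"
proof -
  have "ereal d + ereal (g_psi f x M y y' \<bullet> (z - y')) \<le> ereal c"
    using g by (simp add: subdifferential_def flip: z y')
  then have 1: "d + g_psi f x M y y' \<bullet> (z - y') \<le> c" by simp
  let ?\<rho> = "scaling_fun f x M" and ?\<Omega> = "quartic_model f x M"
  \<comment> \<open>Three-point identity. The term \<open>3 * bregman ?\<rho> y y'\<close> cancels
    against relative smoothness, and relative convexity lowers the factor 3 of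
    \<open>bregman ?\<rho> y z\<close> to \<open>5/2\<close>.\<close>
  have "g_psi f x M y y' \<bullet> (z - y') = - (grad ?\<Omega> y \<bullet> (z - y)) + grad ?\<Omega> y \<bullet> (y' - y)
      + 3 * bregman ?\<rho> y y' + 3 * bregman ?\<rho> y' z - 3 * bregman ?\<rho> y z"
    by (simp add: g_psi_def bregman_def inner_diff_left inner_diff_right inner_add_left algebra_simps)
  with 1 quartic_model_relative_lower[OF M, of x y z] quartic_model_relative_upper[OF M, of x y' y]
  show ?thesis by linarith
qed

text \<open>\<open>g_psi\<close> is the negative gradient at \<open>y'\<close> of the smooth part of
  the subproblem, so this is its first-order optimality condition.\<close>

lemma inner_step_subgradient:
  assumes step: "inner_step f \<psi> x M y y'" and proper: "\<And>u. \<psi> u \<noteq> -\<infinity>"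
    and convex: "convex_ereal \<psi>" and dom: "z \<in> edom \<psi>"
  shows "g_psi f x M y y' \<in> subdifferential \<psi> y'"
proof -
  let ?\<rho> = "scaling_fun f x M" and ?\<Omega> = "quartic_model f x M"
  define h where "h z = grad ?\<Omega> y \<bullet> (z - y) + 3 * bregman ?\<rho> y z" for z
  have min: "is_arg_min (composite h \<psi>) (\<lambda>_. True) y'"
    using step by (simp add: inner_step_def composite_def[abs_def] h_def)
  have h: "(h has_derivative (\<lambda>w. grad ?\<Omega> y \<bullet> w + 3 * (quartic' 0 1 0 M x y' w - grad ?\<rho> y \<bullet> w))) (at y')"
    unfolding h_def[abs_def] bregman_def scaling_fun_eq
    by (auto intro!: derivative_eq_intros quartic_has_derivative)
  have "- grad h y' = g_psi f x M y y'"
    by (rule vector_eq_rdot[THEN iffD1, rule_format])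
      (simp add: inner_grad[OF h] g_psi_def inner_diff_left scaling_fun_eq inner_grad_quartic
        algebra_simps)
  then show ?thesis
    using minimizer_subgradient[OF min h proper convex dom] by simp
qed

end

section \<open>Termination of the inner solver\<close>

text \<open>At \<open>a = 0\<close> the exponent must be positive: \<open>0 ^ 0\<close> is 1, but
  \<open>0 powr 0\<close> is 0.\<close>

lemma powr_third_power:
  fixes a :: real
  assumes "0 \<le> a" and "0 < n"
  shows "(a powr (1/3)) ^ n = a powr (real n / 3)"
  using assms by (cases "a = 0") (simp_all add: powr_powr flip: powr_realpow)

context lipschitz_third_derivative_vec
begin

text \<open>The model and \<open>f\<close> share their gradient at \<open>x\<close>, so
  \<open>G\<close> supports the composite model as well. The regularized model grows by a further
  \<open>M/16 * norm (y - x) ^ 4\<close>, which on the sublevel set cannot exceed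
  \<open>norm G * norm (y - x)\<close>.\<close>

lemma sublevel_model_bound:
  assumes M: "M > 0" "4 * L \<le> M"
    and G: "G \<in> composite_subdifferential f \<psi> x"
    and c: "\<psi> x = ereal c" and d: "\<psi> y = ereal d"
    and le: "quartic_model f x M y + d \<le> quartic_model f x M x + c"
  shows "norm (y - x) \<le> (96 * norm G / M) powr (1/3)"
proof -
  obtain s where s: "s \<in> subdifferential \<psi> x" "G = grad f x + s"
    using G by (auto simp: composite_subdifferential_def)
  have "\<psi> x + ereal (s \<bullet> (y - x)) \<le> \<psi> y"
    using s(1) by (simp add: subdifferential_def)
  then have s2: "c + s \<bullet> (y - x) \<le> d" by (simp add: c d)
  have g: "grad (quartic_model f x M) x \<bullet> (y - x) = grad f x \<bullet> (y - x)"
    unfolding quartic_model_eq inner_grad_quartic by (simp add: quartic'_def inner_grad_f)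
  have "quartic_model f x M x + grad f x \<bullet> (y - x) + 1/2 * bregman (scaling_fun f x M) x y
      \<le> quartic_model f x M y"
    using quartic_model_relative_lower[OF M, of x x y] g by simp
  moreover have "M / 8 * norm (y - x) ^ 4 \<le> bregman (scaling_fun f x M) x y"
    using D2_nonneg[of x "y - x"] unfolding bregman_center unfolding scaling_fun_eq
    by (simp add: quartic_def)
  ultimately have "M / 16 * norm (y - x) ^ 4 \<le> - (G \<bullet> (y - x))"
    using le s2 by (simp add: s(2) inner_add_left)
  also have "\<dots> \<le> norm G * norm (y - x)"
    using Cauchy_Schwarz_ineq2[of G "y - x"] by linarith
  finally have "(M / 16 * norm (y - x) ^ 3) * norm (y - x) \<le> norm G * norm (y - x)"
    by (simp add: eval_nat_numeral mult_ac)
  then have "norm (y - x) ^ 3 \<le> 16 * norm G / M"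
    using M(1) by (cases "y = x") (simp_all add: field_simps)
  \<comment> \<open>The estimate yields 16; the constants of the algorithm are built with the larger
    96.\<close>
  also have "\<dots> \<le> 96 * norm G / M" using M(1) by (simp add: divide_right_mono)
  finally have 3: "norm (y - x) ^ 3 \<le> 96 * norm G / M" .
  have "norm (y - x) = (norm (y - x) ^ 3) powr (1/3)"
    by (cases "y = x") (simp_all flip: powr_numeral add: powr_powr)
  also have "\<dots> \<le> (96 * norm G / M) powr (1/3)"
    by (rule powr_mono2) (use 3 in auto)
  finally show ?thesis .
qed

text \<open>By \<open>bregman_center\<close> this bounds the initial Bregman distance, from which
  the contraction starts.\<close>

lemma scaling_fun_le_beta_const:
  assumes M: "M > 0" and y: "norm (y - x) \<le> (96 * norm G / M) powr (1/3)"
  shows "scaling_fun f x M y \<le> beta_const f x G M"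
proof -
  define D where "D = (96 * norm G / M) powr (1/3)"
  have D: "D ^ 2 = (96 * norm G / M) powr (2/3)" "D ^ 4 = (96 * norm G / M) powr (4/3)"
    using M by (simp_all add: D_def powr_third_power)
  have "scaling_fun f x M y = 1/2 * D2 x (y - x) (y - x) + M/8 * norm (y - x) ^ 4"
    by (simp add: scaling_fun_eq quartic_def)
  also have "\<dots> \<le> 1/2 * (trace (hessian f x) * D ^ 2) + M/8 * D ^ 4"
  proof (intro add_mono mult_left_mono)
    have "D2 x (y - x) (y - x) \<le> trace (hessian f x) * norm (y - x) ^ 2"
      by (rule D2_le_trace)
    also have "\<dots> \<le> trace (hessian f x) * D ^ 2"
      using y by (intro mult_left_mono power_mono trace_hessian_nonneg) (auto simp: D_def)
    finally show "D2 x (y - x) (y - x) \<le> trace (hessian f x) * D ^ 2" .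
    show "norm (y - x) ^ 4 \<le> D ^ 4" using y by (intro power_mono) (auto simp: D_def)
  qed (use M in auto)
  finally show ?thesis unfolding D beta_const_def by (simp add: mult_ac)
qed

lemma not_inner_failure:
  assumes M: "M > 0" "4 * L \<le> M"
    and G: "G \<in> composite_subdifferential f \<psi> x"
    and proper: "\<And>u. \<psi> u \<noteq> -\<infinity>" and y0: "y 0 = x"
    and sub: "\<And>j. j \<le> k \<Longrightarrow> g_psi f x M (y j) (y (Suc j)) \<in> subdifferential \<psi> (y (Suc j))"
  shows "\<not> inner_failure f x G M k (y k) (y (Suc k))"
proof -
  let ?\<beta> = "bregman (scaling_fun f x M)"
  define P where "P j = real_of_ereal (\<psi> (y j))" for j
  define V where "V j = quartic_model f x M (y j) + P j" for j
  define z where "z = y (Suc k)"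
  define D where "D = (96 * norm G / M) powr (1/3)"
  have D2: "D ^ 2 = (96 * norm G / M) powr (2/3)"
    using M by (simp add: D_def powr_third_power)
  have dom: "y j \<in> edom \<psi>" if "j \<le> Suc k" for j
  proof (cases j)
    case 0
    then show ?thesis using G y0 by (auto simp: composite_subdifferential_def subdifferential_def)
  next
    case (Suc l)
    then show ?thesis using sub[of l] that by (auto simp: subdifferential_def)
  qed
  have P: "\<psi> (y j) = ereal (P j)" if "j \<le> Suc k" for j
    using dom[OF that] proper[of "y j"] by (cases "\<psi> (y j)") (auto simp: P_def edom_def)
  have progress: "V (Suc j) + 3 * ?\<beta> (y (Suc j)) (y l) \<le> V l + 5/2 * ?\<beta> (y j) (y l)"
    if "j \<le> k" "l \<le> Suc k" for j l
    using inner_step_progress[OF M sub[OF that(1)] P[OF that(2)] P[of "Suc j"]] that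
    by (simp add: V_def)
  have dec: "V (Suc j) \<le> V j" if "j \<le> k" for j
    using progress[of j j] that bregman_nonneg[OF M(1), of x "y (Suc j)" "y j"]
    by (simp add: bregman_self)
  have mono: "V l \<le> V j" if "j \<le> l" "l \<le> Suc k" for j l
    using that by (induction l rule: dec_induct) (auto intro: order_trans[OF dec])
  have ball: "y j \<in> cball x D" if "j \<le> Suc k" for j
    using sublevel_model_bound[OF M G, of "P 0" "y j" "P j"] P[of 0] P[OF that] mono[of 0 j] that
    by (simp add: y0 V_def D_def dist_norm norm_minus_commute)
  \<comment> \<open>\<open>z\<close> has the lowest value of \<open>V\<close> among the iterates, so
    the values drop out of \<open>progress\<close> and the factors 3 and \<open>5/2\<close>
    remain.\<close>
  have contract: "?\<beta> (y (Suc j)) z \<le> 5/6 * ?\<beta> (y j) z" if "j \<le> k" for j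
    using progress[of j "Suc k"] mono[of "Suc j" "Suc k"] that by (simp add: z_def)
  have "?\<beta> (y j) z \<le> (5/6) ^ j * ?\<beta> x z" if "j \<le> Suc k" for j
    using that
  proof (induction j)
    case (Suc j)
    then show ?case using contract[of j] by simp
  qed (simp add: y0)
  \<comment> \<open>The residual concerns the increment from \<open>y k\<close> to \<open>z\<close>,
    so \<open>k\<close> contractions count, the same power as in
    \<open>inner_failure\<close>.\<close>
  then have "?\<beta> (y k) z \<le> (5/6) ^ k * ?\<beta> x z" by simp
  also have "\<dots> \<le> (5/6) ^ k * beta_const f x G M"
    unfolding bregman_center using ball[of "Suc k"]
    by (intro mult_left_mono scaling_fun_le_beta_const M)
      (auto simp: z_def D_def dist_norm norm_minus_commute)
  finally have "M / 32 * norm (z - y k) ^ 4 \<le> (5/6) ^ k * beta_const f x G M"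
    using bregman_uniformly_convex[OF M(1), where u = "y k" and v = z and x = x] by linarith
  then have step: "norm (z - y k) ^ 4 \<le> 32 / M * ((5/6) ^ k * beta_const f x G M)"
    using M(1) by (simp add: field_simps)
  have L: "L_const f x G M = trace (hessian f x) + 3 * M / 2 * D ^ 2"
    by (simp add: L_const_def D2)
  have b0: "0 \<le> beta_const f x G M"
    using trace_hessian_nonneg[of x] M by (simp add: beta_const_def)
  have "residual f x M (y k) z \<le> 3 * L_const f x G M * norm (z - y k)"
    unfolding L z_def by (rule residual_le[OF M ball ball]) auto
  then have "residual f x M (y k) z ^ 4 \<le> (3 * L_const f x G M * norm (z - y k)) ^ 4"
    by (intro power_mono) (auto simp: residual_def)
  also have "\<dots> = 81 * L_const f x G M ^ 4 * norm (z - y k) ^ 4"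
    by (simp add: power_mult_distrib)
  also have "\<dots> \<le> 81 * L_const f x G M ^ 4 * (32 / M * ((5/6) ^ k * beta_const f x G M))"
    by (intro mult_left_mono step) simp
  also have "\<dots> = 2592 * (L_const f x G M ^ 4 * beta_const f x G M / (M * (6/5) ^ k))"
    by (simp add: power_divide field_simps)
  \<comment> \<open>The constants collected are \<open>81 * 32 = 2592\<close>, below
    \<open>3 ^ 8 / 2 = 3280.5\<close>.\<close>
  also have "\<dots> \<le> 3 ^ 8 / 2 * (L_const f x G M ^ 4 * beta_const f x G M / (M * (6/5) ^ k))"
    using b0 M by (intro mult_right_mono) auto
  finally show ?thesis
    by (simp add: inner_failure_def z_def not_less mult_ac)
qed

text \<open>The new subgradient is Taylor error plus solver residual minus
  \<open>M/2 * d ^ 2\<close> times the step. The last part dominates, so the subgradient points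
  against the step and has size at most \<open>M * d ^ 3\<close>; convexity turns this into a
  decrease of order \<open>M * d ^ 4\<close>.\<close>

lemma inner_success_sufficient_decrease:
  assumes M: "M > 0" "4 * L \<le> M"
    and g: "g_psi f x M y y' \<in> subdifferential \<psi> y'"
    and proper: "\<And>u. \<psi> u \<noteq> -\<infinity>"
    and success: "inner_success f x M \<epsilon> y y'"
    and large: "norm (grad f y' + g_psi f x M y y') > \<epsilon>"
  shows "sufficient_decrease f \<psi> x M y' (grad f y' + g_psi f x M y y')"
proof -
  let ?\<Omega> = "quartic_model f x M" and ?g = "g_psi f x M y y'"
  define v where "v = grad f y' + ?g"
  define h where "h = y' - x"
  define d where "d = norm h"
  define s where "s = grad ?\<Omega> y' + ?g"
  define a where "a = grad f y' - (grad ?\<Omega> y' - (M/2 * d ^ 2) *\<^sub>R h)"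
  have v: "v = (a + s) - (M/2 * d ^ 2) *\<^sub>R h"
    by (simp add: v_def a_def s_def)
  have d0: "d \<ge> 0" by (simp add: d_def)
  have a: "norm a \<le> M / 24 * d ^ 3"
  proof -
    \<comment> \<open>Testing the one-sided Taylor estimate in the direction of the error itself
      bounds its norm.\<close>
    have "a \<bullet> a = D1 (x + h) a - (D1 x a + D2 x h a + D3 x h h a / 2)"
      using inner_grad_quartic[of 1 1 1 M x y' a]
      by (simp add: a_def[THEN arg_cong, of "\<lambda>z. z \<bullet> a"] inner_diff_left inner_grad_f quartic_model_eq
          quartic'_def h_def d_def power2_norm_eq_inner)
    also have "\<dots> \<le> L / 6 * d ^ 3 * norm a"
      unfolding d_def by (rule D1_taylor)
    also have "\<dots> \<le> M / 24 * d ^ 3 * norm a"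
      using M d0 by (intro mult_right_mono) auto
    finally have "norm a * norm a \<le> M / 24 * d ^ 3 * norm a"
      by (simp add: power2_eq_square flip: power2_norm_eq_inner)
    then show ?thesis using M d0 by (cases "a = 0") auto
  qed
  have "norm v \<le> norm (a + s) + norm ((M/2 * d ^ 2) *\<^sub>R h)"
    unfolding v by (rule norm_triangle_ineq4)
  also have "\<dots> \<le> M / 24 * d ^ 3 + norm s + M / 2 * d ^ 3"
    using M a norm_triangle_ineq[of a s] by (simp add: d_def power3_eq_cube power2_eq_square)
  finally have v_le: "norm v \<le> 13 / 24 * (M * d ^ 3) + norm s" by simp
  have Md: "0 \<le> M * d ^ 3" using M d0 by simp
  have s: "norm s \<le> M * d ^ 3 / 6"
    using success unfolding inner_success_def residual_def s_def[symmetric] h_def[symmetric] d_def[symmetric]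
  proof
    \<comment> \<open>Here
      \<open>7 * norm s \<le> \<epsilon> < 13/24 * (M * d ^ 3) + norm s\<close>, so
      \<open>norm s\<close> is below \<open>13/144 * (M * d ^ 3)\<close>.\<close>
    assume "norm s \<le> \<epsilon> / 7"
    then show ?thesis using large v_le Md unfolding v_def[symmetric] by linarith
  qed simp
  have v_le': "norm v \<le> M * d ^ 3" using v_le s Md by linarith
  have "norm v powr (4/3) \<le> (M * d ^ 3) powr (4/3)"
    using v_le' by (intro powr_mono2) auto
  also have "\<dots> = M powr (1/3) * (M * d ^ 4)"
  proof -
    have "(d ^ 3) powr (4/3) = d ^ 4"
      using d0 by (cases "d = 0") (simp_all flip: powr_numeral add: powr_powr)
    moreover have "M powr (4/3) = M powr (1/3) * M"
      using M powr_add[of M "1/3" 1] by simp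
    ultimately show ?thesis using M d0 by (simp add: powr_mult)
  qed
  finally have target: "1 / (6 * M powr (1/3)) * norm v powr (4/3) \<le> M * d ^ 4 / 6"
    using M by (simp add: field_simps)
  have "(a + s) \<bullet> h \<le> norm (a + s) * d"
    unfolding d_def by (rule norm_cauchy_schwarz)
  also have "\<dots> \<le> (5 / 24 * (M * d ^ 3)) * d"
    using a s norm_triangle_ineq[of a s] d0 by (intro mult_right_mono) auto
  also have "\<dots> = 5 / 24 * (M * d ^ 4)" by (simp add: eval_nat_numeral)
  finally have as: "(a + s) \<bullet> h \<le> 5 / 24 * (M * d ^ 4)" .
  have "v \<bullet> h = (a + s) \<bullet> h - M / 2 * d ^ 4"
    by (simp add: v inner_diff_left d_def dot_square_norm eval_nat_numeral)
  moreover have "0 \<le> M * d ^ 4" using M d0 by simp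
  \<comment> \<open>The balance is \<open>1/2 - 5/24 = 7/24\<close>, more than the required
    \<open>1/6\<close>.\<close>
  ultimately have vh: "M * d ^ 4 / 6 \<le> - (v \<bullet> h)" using as by linarith
  obtain q where q: "\<psi> y' = ereal q"
    using g proper[of y'] by (cases "\<psi> y'") (auto simp: subdifferential_def edom_def)
  have le: "composite f \<psi> x \<ge> ereal (f y' + q - v \<bullet> h)"
  proof -
    have "\<psi> y' + ereal (?g \<bullet> (x - y')) \<le> \<psi> x" using g by (simp add: subdifferential_def)
    then have 1: "ereal (q - ?g \<bullet> h) \<le> \<psi> x"
      by (simp add: q h_def inner_diff_right algebra_simps)
    have 2: "f y' - grad f y' \<bullet> h \<le> f x"
      using D1_above_tangent[of y' x] by (simp add: h_def inner_grad_f[symmetric] inner_diff_right)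
    have "ereal (f y' - grad f y' \<bullet> h) + ereal (q - ?g \<bullet> h) \<le> ereal (f x) + \<psi> x"
      using 1 2 by (intro add_mono) auto
    then show ?thesis by (simp add: composite_def v_def inner_add_left algebra_simps)
  qed
  have "ereal (1 / (6 * M powr (1/3)) * norm v powr (4/3)) \<le> ereal (f y' + q - v \<bullet> h) - ereal (f y' + q)"
    using target vh by simp
  also have "\<dots> \<le> composite f \<psi> x - composite f \<psi> y'"
    using le by (intro ereal_minus_mono) (simp_all add: composite_def q)
  finally show ?thesis
    by (simp add: sufficient_decrease_def v_def)
qed

section \<open>Guarantees for the output of the inner solver\<close>

lemma algorithm1_subgradient:
  assumes "algorithm1 f \<psi> x G N \<epsilon> xp \<alpha> g" and "\<And>u. \<psi> u \<noteq> -\<infinity>" "convex_ereal \<psi>" "x \<in> edom \<psi>"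
  shows "g \<in> subdifferential \<psi> xp"
  using assms unfolding algorithm1_def by (blast intro: inner_step_subgradient)

text \<open>Used backwards: a rejected trial must have had a constant below
  \<open>4 * L\<close>.\<close>

lemma algorithm1_accepts:
  assumes run: "algorithm1 f \<psi> x G N \<epsilon> xp \<alpha> g"
    and proper: "\<And>u. \<psi> u \<noteq> -\<infinity>" and convex: "convex_ereal \<psi>"
    and G: "G \<in> composite_subdifferential f \<psi> x"
    and N: "N > 0" "4 * L \<le> N"
  shows "\<alpha> \<noteq> 1" and "norm (grad f xp + g) > \<epsilon> \<Longrightarrow> sufficient_decrease f \<psi> x N xp (grad f xp + g)"
proof -
  have x: "x \<in> edom \<psi>"
    using G by (auto simp: composite_subdifferential_def subdifferential_def)
  obtain y k where y: "y 0 = x" "\<And>j. j \<le> k \<Longrightarrow> inner_step f \<psi> x N (y j) (y (Suc j))"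
    and fin: "if inner_success f x N \<epsilon> (y k) (y (Suc k)) then \<alpha> = 0
            else inner_failure f x G N k (y k) (y (Suc k)) \<and> \<alpha> = 1"
    and out: "xp = y (Suc k)" "g = g_psi f x N (y k) (y (Suc k))"
    using run unfolding algorithm1_def by blast
  have sub: "g_psi f x N (y j) (y (Suc j)) \<in> subdifferential \<psi> (y (Suc j))" if "j \<le> k" for j
    using inner_step_subgradient[OF y(2)[OF that] proper convex x] .
  have success: "inner_success f x N \<epsilon> (y k) (y (Suc k))" "\<alpha> = 0"
    using fin not_inner_failure[of N G \<psi> x y k, OF N G proper y(1) sub] by (auto split: if_splits)
  show "\<alpha> \<noteq> 1" using success by simp
  show "sufficient_decrease f \<psi> x N xp (grad f xp + g)" if "norm (grad f xp + g) > \<epsilon>"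
    using inner_success_sufficient_decrease[OF N sub[OF order_refl] proper success(1)] that
    unfolding out by simp
qed

lemma composite_above_tangent:
  assumes g: "g \<in> subdifferential \<psi> y"
  shows "composite f \<psi> y + ereal ((grad f y + g) \<bullet> (z - y)) \<le> composite f \<psi> z"
proof -
  have "f y + grad f y \<bullet> (z - y) \<le> f z"
    using D1_above_tangent[of y z] by (simp add: inner_grad_f)
  moreover have "\<psi> y + ereal (g \<bullet> (z - y)) \<le> \<psi> z" using g by (simp add: subdifferential_def)
  ultimately have "ereal (f y + grad f y \<bullet> (z - y)) + (\<psi> y + ereal (g \<bullet> (z - y))) \<le> ereal (f z) + \<psi> z"
    by (intro add_mono) auto
  also have "ereal (f y + grad f y \<bullet> (z - y)) + (\<psi> y + ereal (g \<bullet> (z - y)))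
      = composite f \<psi> y + ereal ((grad f y + g) \<bullet> (z - y))"
    by (cases "\<psi> y") (auto simp: composite_def inner_add_left)
  finally show ?thesis by (simp add: composite_def)
qed

end

section \<open>Scalar recursions behind the two phases\<close>

lemma superlinear_phase:
  fixes a :: "nat \<Rightarrow> real"
  assumes pos: "\<And>t. t \<le> n \<Longrightarrow> a t > 0"
    and step: "\<And>t. t < n \<Longrightarrow> a (Suc t) powr (4/3) \<le> a t"
    and big: "a n > 2"
  shows "real n \<le> 1 / log 2 (4/3) * log 2 (log 2 (a 0))"
proof -
  \<comment> \<open>The exponents multiply along the recursion. At \<open>t = n\<close> the base
    exceeds 2, and two logarithms then isolate \<open>n\<close>.\<close>
  have "a t powr ((4/3) ^ t) \<le> a 0" if "t \<le> n" for t
    using that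
  proof (induction t)
    case (Suc t)
    have "a (Suc t) powr ((4/3) ^ Suc t) = (a (Suc t) powr (4/3)) powr ((4/3) ^ t)"
      by (simp add: powr_powr)
    also have "\<dots> \<le> a t powr ((4/3) ^ t)"
      using Suc.prems by (intro powr_mono2 step) auto
    finally show ?case using Suc by simp
  qed (use pos[of 0] in simp)
  from this[of n] have an: "a n powr ((4/3) ^ n) \<le> a 0" by simp
  have "(4/3::real) ^ n = log 2 (2 powr ((4/3) ^ n))" by simp
  also have "\<dots> \<le> log 2 (a n powr ((4/3) ^ n))"
    using big by (subst log_le_cancel_iff) (auto intro!: powr_mono2)
  also have "\<dots> \<le> log 2 (a 0)"
    using an big pos[of 0] by (subst log_le_cancel_iff) auto
  finally have "log 2 ((4/3::real) ^ n) \<le> log 2 (log 2 (a 0))"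
    by (subst log_le_cancel_iff) (auto intro: less_le_trans[of 0 "(4/3) ^ n"])
  then have "real n * log 2 (4/3) \<le> log 2 (log 2 (a 0))"
    by (simp add: log_nat_power)
  then show ?thesis by (simp add: field_simps)
qed

text \<open>For the cube roots \<open>p\<close>, \<open>q\<close> of consecutive values the
  recursion reads \<open>q ^ 3 * (1 + q) \<le> p ^ 3\<close>, and their reciprocals grow by a fixed
  amount.\<close>

lemma sublinear_phase:
  fixes a :: "nat \<Rightarrow> real"
  assumes pos: "\<And>t. t \<le> T \<Longrightarrow> a t > 0"
    and step: "\<And>t. t < T \<Longrightarrow> a (Suc t) + a (Suc t) powr (4/3) \<le> a t"
    and small: "a m \<le> 2" and mT: "m \<le> T"
  shows "real (T - m) \<le> 7 * a T powr (-1/3)"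
proof -
  define s where "s t = a t powr (1/3)" for t
  have s_pos: "s t > 0" if "t \<le> T" for t using pos[OF that] by (simp add: s_def)
  have s3: "s t ^ 3 = a t" and s4: "s t ^ 4 = a t powr (4/3)" if "t \<le> T" for t
    using pos[OF that] by (simp_all add: s_def powr_third_power)
  have a2: "a t \<le> 2" if "m \<le> t" "t \<le> T" for t
    using that
  proof (induction t rule: dec_induct)
    case (step t)
    then show ?case using assms(2)[of t] by (smt (verit) Suc_le_lessD less_imp_le_nat powr_ge_zero)
  qed (rule small)
  have inv: "1 / s t + 1/7 \<le> 1 / s (Suc t)" if t: "m \<le> t" "t < T" for t
  proof -
    define p q where "p = s t" and "q = s (Suc t)"
    have pq: "p > 0" "q > 0" using s_pos t by (auto simp: p_def q_def)
    have "q ^ 3 \<le> 2" using a2[of "Suc t"] s3[of "Suc t"] t by (simp add: q_def)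
    also have "\<dots> \<le> (4/3) ^ 3" by (simp add: power3_eq_cube)
    finally have q: "q \<le> 4/3" using pq by (subst (asm) power_mono_iff) auto
    have le: "q ^ 3 * (1 + q) \<le> p ^ 3"
      using step[OF t(2)] s3[of t] s3[of "Suc t"] s4[of "Suc t"] t
      by (simp add: p_def q_def distrib_left power_Suc[symmetric] eval_nat_numeral mult_ac)
    \<comment> \<open>By Bernoulli it suffices that \<open>(1 + q) * (1 - 3 * q / 7)\<close> is at
      least 1, that is \<open>3 * q ^ 2 \<le> 4 * q\<close>. This holds up to
      \<open>q = 4/3\<close>, whose cube \<open>64/27\<close> exceeds the starting level 2 of this
      phase.\<close>
    have "1 - 3 * (q / 7) \<le> (1 - q / 7) ^ 3"
      using Bernoulli_inequality[of "- (q / 7)" 3] q by simp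
    then have "(1 + q) * (1 - 3 * (q / 7)) \<le> (1 + q) * (1 - q / 7) ^ 3"
      using pq by (intro mult_left_mono) auto
    moreover have "1 \<le> (1 + q) * (1 - 3 * (q / 7))"
      using mult_left_mono[OF q, of q] pq by (simp add: algebra_simps)
    ultimately have "1 \<le> (1 + q) * (1 - q / 7) ^ 3" by linarith
    then have "q ^ 3 * 1 \<le> q ^ 3 * ((1 + q) * (1 - q / 7) ^ 3)"
      using pq by (intro mult_left_mono) auto
    also have "\<dots> = (q ^ 3 * (1 + q)) * (1 - q / 7) ^ 3" by simp
    also have "\<dots> \<le> p ^ 3 * (1 - q / 7) ^ 3"
      using q by (intro mult_right_mono le) auto
    finally have "q ^ 3 \<le> (p * (1 - q / 7)) ^ 3" by (simp add: power_mult_distrib)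
    then have "q \<le> p * (1 - q / 7)"
      using pq q by (subst (asm) power_mono_iff) auto
    then have "q / (p * q) \<le> p * (1 - q / 7) / (p * q)"
      using pq by (intro divide_right_mono) auto
    then show ?thesis
      unfolding p_def[symmetric] q_def[symmetric] using pq by (simp add: field_simps)
  qed
  have "real (t - m) / 7 \<le> 1 / s t" if "m \<le> t" "t \<le> T" for t
    using that
  proof (induction t rule: dec_induct)
    case base
    then show ?case using s_pos[of m] by simp
  next
    case (step t)
    then have "real (t - m) / 7 \<le> 1 / s t" "1 / s t + 1/7 \<le> 1 / s (Suc t)"
      using inv[of t] by auto
    moreover have "real (Suc t - m) / 7 = real (t - m) / 7 + 1/7"
      using step.hyps by (simp add: Suc_diff_le add_divide_distrib)
    ultimately show ?case by linarith
  qed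
  from this[of T] mT have "real (T - m) / 7 \<le> 1 / s T" by simp
  then show ?thesis by (simp add: s_def powr_minus_divide)
qed

text \<open>For the upper bound, either the index is 0 and \<open>N\<close> is unchanged, or its
  predecessor misses \<open>2 * M\<^sub>0\<close>, so that one doubling stays below
  \<open>4 * M\<^sub>0\<close>.\<close>

lemma first_index_props:
  assumes "M\<^sub>0 > 0" "N > 0"
  shows "2 * M\<^sub>0 \<le> 2 ^ first_index M\<^sub>0 N * N"
    and "N \<le> K \<Longrightarrow> 4 * M\<^sub>0 \<le> K \<Longrightarrow> 2 ^ first_index M\<^sub>0 N * N \<le> K"
proof -
  obtain n where "2 * M\<^sub>0 / N < 2 ^ n" using real_arch_pow[of 2 "2 * M\<^sub>0 / N"] by auto
  then have ex: "2 * M\<^sub>0 \<le> 2 ^ n * N" using assms by (simp add: field_simps)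
  show "2 * M\<^sub>0 \<le> 2 ^ first_index M\<^sub>0 N * N"
    unfolding first_index_def by (rule LeastI[of _ n]) (use ex in simp)
  show "2 ^ first_index M\<^sub>0 N * N \<le> K" if "N \<le> K" "4 * M\<^sub>0 \<le> K"
  proof (cases "first_index M\<^sub>0 N")
    case 0
    then show ?thesis using that by simp
  next
    case (Suc q)
    then have "\<not> 2 * M\<^sub>0 \<le> 2 ^ q * N"
      unfolding first_index_def by (intro not_less_Least) simp
    then show ?thesis using that unfolding Suc by simp
  qed
qed

section \<open>Complexity of the outer method\<close>

lemma ereal_is_arg_min_le: "is_arg_min F (\<lambda>_. True) z \<Longrightarrow> F z \<le> F y" for F :: "'a \<Rightarrow> ereal"
  by (auto simp: is_arg_min_def not_less)

lemma two_powi_pred: "2 powi (int n - 1) * (N::real) = 2 ^ n * N / 2"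
  by (simp add: power_int_diff)

text \<open>The hypotheses on the first accurate trial are kept out of this context; its facts hold
  for every run.\<close>

locale algorithm2_run = lipschitz_third_derivative_vec f L\<^sub>f
  for f :: "real^'n \<Rightarrow> real" and L\<^sub>f :: real +
  fixes \<psi> :: "real^'n \<Rightarrow> ereal" and R\<^sub>0 M\<^sub>0 \<epsilon> :: real and x\<^sub>0 xs :: "real^'n"
    and x G :: "nat \<Rightarrow> real^'n" and M :: "nat \<Rightarrow> real" and i :: "nat \<Rightarrow> nat"
    and xp g :: "nat \<Rightarrow> nat \<Rightarrow> real^'n" and \<alpha> :: "nat \<Rightarrow> nat \<Rightarrow> nat" and T :: nat
  assumes proper: "\<And>u. \<psi> u \<noteq> -\<infinity>"
    and convex: "convex_ereal \<psi>"
    and minimizer: "is_arg_min (composite f \<psi>) (\<lambda>_. True) xs"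
    and R0_pos: "R\<^sub>0 > 0"
    and R0_bound: "\<And>u. composite f \<psi> u \<le> composite f \<psi> x\<^sub>0 \<Longrightarrow> norm (u - xs) \<le> R\<^sub>0"
    and M0_pos: "M\<^sub>0 > 0"
    and run: "algorithm2 f \<psi> x\<^sub>0 M\<^sub>0 \<epsilon> T x G M i xp \<alpha> g"
begin

section \<open>Bounds on the regularization constants\<close>

definition H :: real where "H = max (4 * M\<^sub>0) (8 * L\<^sub>f)"

lemma half_H: "max (2 * M\<^sub>0) (4 * L\<^sub>f) = H / 2"
  by (auto simp: H_def max_def)

lemma H_pos: "H > 0"
  using M0_pos by (simp add: H_def)

lemma initial: "x 0 = x\<^sub>0" "M 0 = M\<^sub>0" "G 0 \<in> composite_subdifferential f \<psi> x\<^sub>0"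
  using run by (auto simp: algorithm2_def)

lemma first_le: "t \<le> T \<Longrightarrow> first_index M\<^sub>0 (M t) \<le> i t"
  using run by (auto simp: algorithm2_def)

lemma trial:
  "t \<le> T \<Longrightarrow> first_index M\<^sub>0 (M t) \<le> l \<Longrightarrow> l \<le> i t \<Longrightarrow>
    algorithm1 f \<psi> (x t) (G t) (2 ^ l * M t) \<epsilon> (xp t l) (\<alpha> t l) (g t l)"
  using run by (auto simp: algorithm2_def)

lemma rejected:
  "t \<le> T \<Longrightarrow> first_index M\<^sub>0 (M t) \<le> l \<Longrightarrow> l < i t \<Longrightarrow>
    \<alpha> t l = 1 \<or> norm (grad f (xp t l) + g t l) > \<epsilon> \<and>
      \<not> sufficient_decrease f \<psi> (x t) (2 ^ l * M t) (xp t l) (grad f (xp t l) + g t l)"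
  using run by (auto simp: algorithm2_def)

lemma accepted:
  assumes "t < T"
  shows "sufficient_decrease f \<psi> (x t) (2 ^ i t * M t) (x (Suc t)) (G (Suc t))"
    and "x (Suc t) = xp t (i t)" and "G (Suc t) = grad f (x (Suc t)) + g t (i t)"
    and "M (Suc t) = 2 ^ i t * M t / 2"
  using run assms unfolding algorithm2_def two_powi_pred by auto

text \<open>The trial is either the first of its iteration, with constant at most
  \<open>max (M t) (4 * M\<^sub>0)\<close>, or it doubles a rejected constant, which was below
  \<open>4 * L\<^sub>f\<close>.\<close>

lemma trial_constant:
  assumes t: "t \<le> T" and G: "G t \<in> composite_subdifferential f \<psi> (x t)"
    and M: "M\<^sub>0 \<le> M t" "M t \<le> H / 2"
  shows "2 * M\<^sub>0 \<le> 2 ^ i t * M t" and "2 ^ i t * M t \<le> H"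
proof -
  note Mt = less_le_trans[OF M0_pos M(1)]
  have "2 * M\<^sub>0 \<le> 2 ^ first_index M\<^sub>0 (M t) * M t" by (rule first_index_props[OF M0_pos Mt])
  also have "\<dots> \<le> 2 ^ i t * M t"
    using first_le[OF t] Mt by (intro mult_right_mono power_increasing) auto
  finally show "2 * M\<^sub>0 \<le> 2 ^ i t * M t" .
  show "2 ^ i t * M t \<le> H"
  proof (cases "i t = first_index M\<^sub>0 (M t)")
    case True
    then show ?thesis
      using first_index_props(2)[OF M0_pos Mt, of H] M(2) H_pos by (simp add: H_def)
  next
    case False
    then obtain l where l: "i t = Suc l" "first_index M\<^sub>0 (M t) \<le> l"
      using first_le[OF t] by (cases "i t") auto
    have N: "0 < 2 ^ l * M t" using Mt by simp
    have "\<not> 4 * L\<^sub>f \<le> 2 ^ l * M t"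
      using algorithm1_accepts[OF trial[OF t l(2)] proper convex G N] rejected[OF t l(2)] l(1) by auto
    then show ?thesis by (simp add: l(1) H_def)
  qed
qed

lemma iterates:
  assumes "t \<le> T"
  shows "G t \<in> composite_subdifferential f \<psi> (x t)" and "M\<^sub>0 \<le> M t" and "M t \<le> H / 2"
proof -
  \<comment> \<open>Joint induction: the bounds on the next constant rest on the solver guarantees,
    which need the current subgradient.\<close>
  have "G t \<in> composite_subdifferential f \<psi> (x t) \<and> M\<^sub>0 \<le> M t \<and> M t \<le> H / 2"
    using assms
  proof (induction t)
    case 0
    then show ?case using initial M0_pos by (simp add: H_def)
  next
    case (Suc t)
    then have t: "t < T" "t \<le> T" and IH: "G t \<in> composite_subdifferential f \<psi> (x t)"
      "M\<^sub>0 \<le> M t" "M t \<le> H / 2" by auto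
    have dom: "x t \<in> edom \<psi>"
      using IH(1) by (auto simp: composite_subdifferential_def subdifferential_def)
    have "g t (i t) \<in> subdifferential \<psi> (xp t (i t))"
      by (rule algorithm1_subgradient[OF trial[OF t(2) first_le[OF t(2)] order_refl] proper convex dom])
    then show ?case
      using trial_constant[OF t(2) IH] accepted(2-4)[OF t(1)]
      by (simp add: composite_subdifferential_def)
  qed
  then show "G t \<in> composite_subdifferential f \<psi> (x t)" "M\<^sub>0 \<le> M t" "M t \<le> H / 2" by auto
qed

section \<open>The objective gap along the run\<close>

definition gap :: "nat \<Rightarrow> real" where
  "gap t = real_of_ereal (composite f \<psi> (x t) - composite f \<psi> xs)"

lemma xs_finite: "\<bar>composite f \<psi> xs\<bar> \<noteq> \<infinity>"
proof -
  have "x\<^sub>0 \<in> edom \<psi>"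
    using initial(3) by (auto simp: composite_subdifferential_def subdifferential_def)
  then have "composite f \<psi> xs < \<infinity>"
    using ereal_is_arg_min_le[OF minimizer, of x\<^sub>0]
    by (auto simp: composite_def edom_def intro: le_less_trans)
  then show ?thesis using proper[of xs] by (cases "\<psi> xs") (auto simp: composite_def)
qed

text \<open>\<open>real_of_ereal\<close> sends infinite values to 0; this shows that the default
  never occurs up to iteration \<open>T\<close>.\<close>

lemma composite_iterate:
  assumes "t \<le> T"
  shows "composite f \<psi> (x t) = composite f \<psi> xs + ereal (gap t)"
proof -
  have "x t \<in> edom \<psi>"
    using iterates(1)[OF assms] by (auto simp: composite_subdifferential_def subdifferential_def)
  then show ?thesis
    using proper[of "x t"] xs_finite
    by (cases "\<psi> (x t)"; cases "composite f \<psi> xs") (auto simp: gap_def composite_def edom_def)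
qed

lemma gap_ereal: "t \<le> T \<Longrightarrow> composite f \<psi> (x t) - composite f \<psi> xs = ereal (gap t)"
  using composite_iterate[of t] xs_finite by (cases "composite f \<psi> xs") auto

lemma gap_nonneg: "t \<le> T \<Longrightarrow> 0 \<le> gap t"
  using ereal_is_arg_min_le[OF minimizer, of "x t"] composite_iterate[of t] xs_finite
  by (cases "composite f \<psi> xs") auto

lemma gap_decrease:
  assumes t: "t < T"
  shows "gap (Suc t) + 1 / (6 * H powr (1/3)) * norm (G (Suc t)) powr (4/3) \<le> gap t"
proof -
  let ?N = "2 ^ i t * M t" and ?n = "norm (G (Suc t)) powr (4/3)"
  have tT: "t \<le> T" "Suc t \<le> T" using t by auto
  have N: "0 < ?N" "?N \<le> H"
    using trial_constant[OF tT(1) iterates[OF tT(1)]] M0_pos by auto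
  have "ereal (1 / (6 * ?N powr (1/3)) * ?n) \<le> composite f \<psi> (x t) - composite f \<psi> (x (Suc t))"
    using accepted(1)[OF t] by (simp add: sufficient_decrease_def)
  also have "\<dots> = ereal (gap t - gap (Suc t))"
    using composite_iterate[OF tT(1)] composite_iterate[OF tT(2)] xs_finite
    by (cases "composite f \<psi> xs") auto
  finally have "1 / (6 * ?N powr (1/3)) * ?n \<le> gap t - gap (Suc t)" by simp
  moreover have "1 / (6 * H powr (1/3)) * ?n \<le> 1 / (6 * ?N powr (1/3)) * ?n"
  proof (rule mult_right_mono)
    have "1 / (6 * H powr (1/3)) \<le> 1 / (6 * N powr (1/3))" if "0 < N" "N \<le> H" for N
      using that by (intro divide_left_mono mult_left_mono powr_mono2) auto
    from this[OF N] show "1 / (6 * H powr (1/3)) \<le> 1 / (6 * ?N powr (1/3))" .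
  qed simp
  ultimately show ?thesis by simp
qed

lemma gap_mono: "t \<le> T \<Longrightarrow> gap t \<le> gap 0"
proof (induction t)
  case (Suc t)
  then show ?case
    using gap_decrease[of t] H_pos
    by (smt (verit) Suc_le_lessD less_imp_le_nat mult_nonneg_nonneg powr_ge_zero zero_le_divide_1_iff)
qed simp

text \<open>Monotonicity keeps the iterate in the initial level set, hence within
  \<open>R\<^sub>0\<close> of \<open>xs\<close>; the subgradient inequality is tested at
  \<open>xs\<close>.\<close>

lemma gap_le_norm:
  assumes t: "Suc t \<le> T"
  shows "gap (Suc t) \<le> R\<^sub>0 * norm (G (Suc t))"
proof -
  have "composite f \<psi> (x (Suc t)) \<le> composite f \<psi> x\<^sub>0"
    using composite_iterate[OF t] composite_iterate[of 0] gap_mono[OF t] initial(1) xs_finite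
    by (cases "composite f \<psi> xs") auto
  then have R: "norm (x (Suc t) - xs) \<le> R\<^sub>0" by (rule R0_bound)
  obtain s where "s \<in> subdifferential \<psi> (x (Suc t))" "G (Suc t) = grad f (x (Suc t)) + s"
    using iterates(1)[OF t] by (auto simp: composite_subdifferential_def)
  then have "composite f \<psi> (x (Suc t)) + ereal (G (Suc t) \<bullet> (xs - x (Suc t))) \<le> composite f \<psi> xs"
    using composite_above_tangent[of s \<psi> "x (Suc t)" xs] by simp
  then have "gap (Suc t) \<le> G (Suc t) \<bullet> (x (Suc t) - xs)"
    unfolding composite_iterate[OF t] using xs_finite
    by (cases "composite f \<psi> xs") (auto simp: inner_diff_right)
  also have "\<dots> \<le> norm (G (Suc t)) * norm (x (Suc t) - xs)" by (rule norm_cauchy_schwarz)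
  also have "\<dots> \<le> norm (G (Suc t)) * R\<^sub>0" using R by (intro mult_left_mono) auto
  finally show ?thesis by (simp add: mult.commute)
qed

text \<open>Dividing the gap by this constant makes the recursion free of parameters.\<close>

definition K :: real where "K = 6 ^ 3 * (H * R\<^sub>0 ^ 4)"

lemma K_pos: "K > 0"
  using H_pos R0_pos by (simp add: K_def)

text \<open>The origin of \<open>6 ^ 3\<close>: its cube root absorbs the factor 6 of the sufficient
  decrease condition.\<close>

lemma K_powr: "K powr (1/3) = 6 * H powr (1/3) * R\<^sub>0 powr (4/3)"
proof -
  have "(6 ^ 3 :: real) powr (1/3) = 6"
    using powr_powr[of "6::real" 3 "1/3"] by (simp add: powr_numeral)
  moreover have "(R\<^sub>0 ^ 4) powr (1/3) = R\<^sub>0 powr (4/3)"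
    using R0_pos powr_powr[of "R\<^sub>0" 4 "1/3"] by (simp add: powr_numeral)
  ultimately show ?thesis
    using H_pos R0_pos unfolding K_def by (simp add: powr_mult)
qed

lemma scaled_gap_recursion:
  assumes t: "t < T"
  shows "gap (Suc t) / K + (gap (Suc t) / K) powr (4/3) \<le> gap t / K"
proof -
  have tT: "Suc t \<le> T" using t by simp
  have g0: "0 \<le> gap (Suc t)" by (rule gap_nonneg[OF tT])
  have "gap (Suc t) powr (4/3) / R\<^sub>0 powr (4/3) = (gap (Suc t) / R\<^sub>0) powr (4/3)"
    using g0 R0_pos by (simp add: powr_divide)
  also have "\<dots> \<le> norm (G (Suc t)) powr (4/3)"
    using gap_le_norm[OF tT] g0 R0_pos
    by (intro powr_mono2) (auto simp: pos_divide_le_eq mult.commute)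
  finally have "gap (Suc t) powr (4/3) / R\<^sub>0 powr (4/3) \<le> norm (G (Suc t)) powr (4/3)" .
  then have "1 / (6 * H powr (1/3)) * (gap (Suc t) powr (4/3) / R\<^sub>0 powr (4/3))
      \<le> 1 / (6 * H powr (1/3)) * norm (G (Suc t)) powr (4/3)"
    using H_pos by (intro mult_left_mono) auto
  then have "gap (Suc t) + gap (Suc t) powr (4/3) / K powr (1/3) \<le> gap t"
    using gap_decrease[OF t] unfolding K_powr by simp
  then have "(gap (Suc t) + gap (Suc t) powr (4/3) / K powr (1/3)) / K \<le> gap t / K"
    using K_pos by (intro divide_right_mono) auto
  \<comment> \<open>Splitting \<open>K powr (4/3)\<close> as \<open>K powr (1/3) * K\<close> lets
    one constant scale both terms.\<close>
  moreover have "(gap (Suc t) / K) powr (4/3) = gap (Suc t) powr (4/3) / K powr (1/3) / K"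
    using g0 K_pos powr_add[of K "1/3" 1] by (simp add: powr_divide)
  ultimately show ?thesis by (simp add: add_divide_distrib)
qed

text \<open>Iteration \<open>t\<close> makes at most \<open>i t + 1\<close> trials and changes
  \<open>log 2 (M t)\<close> by \<open>i t - 1\<close>, so the count beyond two trials per iteration
  telescopes.\<close>

lemma card_executions_le:
  "real (card (executions M\<^sub>0 M i T)) \<le> 2 * (real T + 1) + log 2 (H / 2) - log 2 M\<^sub>0"
proof -
  have Mpos: "0 < M t" if "t \<le> T" for t using iterates(2)[OF that] M0_pos by simp
  have log_step: "log 2 (2 ^ i t * M t / 2) = real (i t) - 1 + log 2 (M t)" if "t \<le> T" for t
    using Mpos[OF that] by (simp add: log_divide log_mult log_nat_power)
  have tel: "(\<Sum>t<n. real (i t) - 1) = log 2 (M n) - log 2 M\<^sub>0" if "n \<le> T" for n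
    using that
  proof (induction n)
    case (Suc n)
    then show ?case using log_step[of n] by (simp add: accepted(4))
  qed (simp add: initial)
  have "card (executions M\<^sub>0 M i T) = (\<Sum>t\<le>T. card {first_index M\<^sub>0 (M t)..i t})"
    unfolding executions_def by (rule card_SigmaI) auto
  also have "\<dots> \<le> (\<Sum>t\<le>T. i t + 1)"
    by (intro sum_mono) simp
  finally have "real (card (executions M\<^sub>0 M i T)) \<le> real (\<Sum>t\<le>T. i t + 1)"
    by (rule of_nat_mono)
  also have "\<dots> = (\<Sum>t\<le>T. real (i t) - 1) + 2 * (real T + 1)"
    by (simp add: sum.distrib sum_subtractf)
  \<comment> \<open>The last trial of iteration \<open>T\<close> need not be accepted; half its
    constant takes the place of the next \<open>M\<close> in the telescope.\<close>
  also have "(\<Sum>t\<le>T. real (i t) - 1) = log 2 (2 ^ i T * M T / 2) - log 2 M\<^sub>0"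
    using tel[of T] log_step[of T] by (simp flip: lessThan_Suc_atMost)
  also have "log 2 (2 ^ i T * M T / 2) \<le> log 2 (H / 2)"
    using trial_constant(2)[OF order_refl iterates[OF order_refl]] Mpos[of T] H_pos
    by (subst log_le_cancel_iff) auto
  finally show ?thesis by simp
qed

end

section \<open>The complexity bound\<close>

theorem corollary3p1:
  fixes f :: "real^'n \<Rightarrow> real" and \<psi> :: "real^'n \<Rightarrow> ereal"
    and L\<^sub>f R\<^sub>0 M\<^sub>0 \<epsilon> :: real and x\<^sub>0 xs :: "real^'n"
    and x G :: "nat \<Rightarrow> real^'n" and M :: "nat \<Rightarrow> real" and i :: "nat \<Rightarrow> nat"
    and xp g :: "nat \<Rightarrow> nat \<Rightarrow> real^'n" and \<alpha> :: "nat \<Rightarrow> nat \<Rightarrow> nat"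
    and T j m :: nat
  assumes f_convex: "convex_on UNIV f"
    and f_diff: "three_times_differentiable f"
    and f_lipschitz: "\<And>u v. norm (fderiv (fderiv (fderiv f)) u - fderiv (fderiv (fderiv f)) v)
                               \<le> L\<^sub>f * norm (u - v)"
    and psi_proper: "\<And>u. \<psi> u \<noteq> -\<infinity>"
    and psi_convex: "convex_ereal \<psi>"
    and minimizer: "is_arg_min (composite f \<psi>) (\<lambda>_. True) xs"
    and x0_dom: "x\<^sub>0 \<in> edom \<psi>"
    and R0_pos: "R\<^sub>0 > 0"
    and R0_bound: "\<And>u. composite f \<psi> u \<le> composite f \<psi> x\<^sub>0 \<Longrightarrow> norm (u - xs) \<le> R\<^sub>0"
    and eps_pos: "\<epsilon> > 0"
    and M0_pos: "M\<^sub>0 > 0"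
    and run: "algorithm2 f \<psi> x\<^sub>0 M\<^sub>0 \<epsilon> T x G M i xp \<alpha> g"
    and trial_T: "(T, j) \<in> executions M\<^sub>0 M i T"
    and trial_T_good: "eps_solution f \<psi> xs \<epsilon> (xp T j) (grad f (xp T j) + g T j)"
    and trial_T_first: "\<And>t l. (t, l) \<in> executions M\<^sub>0 M i T \<Longrightarrow> t < T \<or> t = T \<and> l < j \<Longrightarrow>
                          \<not> eps_solution f \<psi> xs \<epsilon> (xp t l) (grad f (xp t l) + g t l)"
    and m_reached: "composite f \<psi> (x m) - composite f \<psi> xs
                      \<le> ereal (6 ^ 3 * (4 * max (2 * M\<^sub>0) (4 * L\<^sub>f) * R\<^sub>0 ^ 4))"
    and m_first: "\<And>t. t < m \<Longrightarrow>
                    \<not> composite f \<psi> (x t) - composite f \<psi> xs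
                      \<le> ereal (6 ^ 3 * (4 * max (2 * M\<^sub>0) (4 * L\<^sub>f) * R\<^sub>0 ^ 4))"
    and T_gt_m: "T > m"
  shows "real (card (executions M\<^sub>0 M i T))
           \<le> 2 * (real m + 1)
             + 84 * max (4 * M\<^sub>0) (8 * L\<^sub>f) powr (1/3) * R\<^sub>0 powr (4/3) * \<epsilon> powr (-1/3)
             + log 2 (max (2 * M\<^sub>0) (4 * L\<^sub>f)) - log 2 M\<^sub>0
         \<and> (m > 0 \<longrightarrow> real m \<le> 1 + 1 / log 2 (4/3) *
           log 2 (log 2 (real_of_ereal (composite f \<psi> x\<^sub>0 - composite f \<psi> xs)
                          / (6 ^ 3 * (max (4 * M\<^sub>0) (8 * L\<^sub>f) * R\<^sub>0 ^ 4)))))"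
proof -
  interpret algorithm2_run f L\<^sub>f \<psi> R\<^sub>0 M\<^sub>0 \<epsilon> x\<^sub>0 xs x G M i xp g \<alpha> T
    using f_convex f_diff f_lipschitz psi_proper psi_convex minimizer R0_pos R0_bound M0_pos run
    by unfold_locales
  \<comment> \<open>In units of \<open>K\<close> the threshold defining \<open>m\<close> is
    2.\<close>
  have threshold: "6 ^ 3 * (4 * max (2 * M\<^sub>0) (4 * L\<^sub>f) * R\<^sub>0 ^ 4) = 2 * K"
    by (simp add: half_H K_def)
  \<comment> \<open>The accepted trial of an earlier iteration precedes \<open>(T, j)\<close> and so
    is not accurate; of the minimum only the gap is kept.\<close>
  have gap_large: "\<epsilon> < gap (Suc t)" if t: "t < T" for t
  proof -
    have "(t, i t) \<in> executions M\<^sub>0 M i T"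
      using first_le[of t] t by (simp add: executions_def)
    then have "\<not> eps_solution f \<psi> xs \<epsilon> (x (Suc t)) (G (Suc t))"
      using trial_T_first[of t "i t"] t accepted(2,3)[OF t] by simp
    then show ?thesis
      using gap_ereal[of "Suc t"] t by (simp add: eps_solution_def not_le)
  qed
  \<comment> \<open>The starting point is no trial point; its gap is compared with that of
    \<open>x 1\<close>, available because \<open>T > m\<close>.\<close>
  have gap_pos: "0 < gap t" if "t \<le> T" for t
  proof (cases t)
    case 0
    then show ?thesis
      using gap_large[of 0] gap_mono[of "Suc 0"] T_gt_m eps_pos by simp
  next
    case (Suc l)
    then show ?thesis using gap_large[of l] that eps_pos by simp
  qed
  define a where "a t = gap t / K" for t
  have a_pos: "a t > 0" if "t \<le> T" for t
    using gap_pos[OF that] K_pos by (simp add: a_def)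
  have a_step: "a (Suc t) + a (Suc t) powr (4/3) \<le> a t" if "t < T" for t
    unfolding a_def by (rule scaled_gap_recursion[OF that])
  have a_m: "a m \<le> 2"
    using m_reached T_gt_m K_pos unfolding threshold by (simp add: gap_ereal a_def pos_divide_le_eq)
  have "real (T - m) \<le> 7 * a T powr (-1/3)"
    using a_pos a_step a_m T_gt_m by (intro sublinear_phase) auto
  also have "\<dots> \<le> 7 * (\<epsilon> / K) powr (-1/3)"
  proof -
    have "\<epsilon> / K \<le> a T"
      using gap_large[of "T - 1"] T_gt_m K_pos by (simp add: a_def divide_right_mono)
    then show ?thesis
      using eps_pos K_pos by (intro mult_left_mono powr_mono2') auto
  qed
  \<comment> \<open>Here \<open>7 * 6\<close> gives 42, and two trials per iteration make it
    84.\<close>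
  also have "(\<epsilon> / K) powr (-1/3) = 6 * H powr (1/3) * R\<^sub>0 powr (4/3) * \<epsilon> powr (-1/3)"
    using eps_pos K_pos by (simp add: powr_divide powr_minus_divide flip: K_powr)
  finally have "real T \<le> real m + 42 * H powr (1/3) * R\<^sub>0 powr (4/3) * \<epsilon> powr (-1/3)"
    using T_gt_m by simp
  then have executions: "real (card (executions M\<^sub>0 M i T))
           \<le> 2 * (real m + 1) + 84 * H powr (1/3) * R\<^sub>0 powr (4/3) * \<epsilon> powr (-1/3)
             + log 2 (H / 2) - log 2 M\<^sub>0"
    using card_executions_le by simp
  \<comment> \<open>Index \<open>m - 1\<close> still lies above the threshold, which explains the
    summand 1. For \<open>m = 0\<close> only \<open>a 0 \<le> 2\<close> is known, and the nested
    logarithm need not be meaningful.\<close>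
  have "real m \<le> 1 + 1 / log 2 (4/3) * log 2 (log 2 (a 0))" if m: "m > 0"
  proof -
    have "a (m - 1) > 2"
      using m_first[of "m - 1"] T_gt_m m K_pos unfolding threshold
      by (simp add: gap_ereal a_def pos_less_divide_eq not_le)
    moreover have "a (Suc t) powr (4/3) \<le> a t" if t: "t < m - 1" for t
    proof -
      have "t < T" "Suc t \<le> T" using t T_gt_m by auto
      then show ?thesis using a_step[of t] a_pos[of "Suc t"] by linarith
    qed
    ultimately have "real (m - 1) \<le> 1 / log 2 (4/3) * log 2 (log 2 (a 0))"
      using a_pos T_gt_m by (intro superlinear_phase) auto
    then show ?thesis using m by (simp add: of_nat_diff)
  qed
  moreover have "a 0 = real_of_ereal (composite f \<psi> x\<^sub>0 - composite f \<psi> xs)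
                          / (6 ^ 3 * (max (4 * M\<^sub>0) (8 * L\<^sub>f) * R\<^sub>0 ^ 4))"
    by (simp add: a_def gap_def K_def H_def initial)
  ultimately show ?thesis
    using executions unfolding half_H by (simp add: H_def)
qed

end
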